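(* Let $m,n\ge 2$ and let $\mathcal{A}=(a_{i_1i_2\dots i_m})\in\mathbb{R}^{[m,n]}$ be a strong $\mathcal{M}$-tensor with $a_{ii\dots i}=1$ for $i=1,\dots,n$. (a) Let $1\le s,k\le n-1$. For any $\alpha_i\in[0,1]$ $(i=1,\dots,n-s)$ and any $\beta_j\in[0,1]$ $(j=k+1,\dots,n)$, the splittings $\mathcal{A}_{\boldsymbol{\alpha}\boldsymbol{\beta}}(s,k)=\mathcal{E}_1-\mathcal{F}_1=\mathcal{E}_2-\mathcal{F}_2$, $\mathcal{A}_{\boldsymbol{\alpha}}(s)=\mathcal{E}_3-\mathcal{F}_3$ and $\mathcal{A}_{\boldsymbol{\beta}}(k)=\mathcal{E}_4-\mathcal{F}_4$, where $$\mathcal{E}_1=P_{\boldsymbol{\alpha}\boldsymbol{\beta}}(s,k)\mathcal{I}_m,\quad \mathcal{F}_1=P_{\boldsymbol{\alpha}\boldsymbol{\beta}}(s,k)(\mathcal{L}+\mathcal{F}),$$ $$\mathcal{E}_2=\mathcal{I}_m,\quad \mathcal{F}_2=P_{\boldsymbol{\alpha}\boldsymbol{\beta}}(s,k)(\mathcal{L}+\mathcal{F})-(S_{\boldsymbol{\alpha}}^{s}+K_{\boldsymbol{\beta}}^{k})\mathcal{I}_m,$$ $$\mathcal{E}_3=\mathcal{I}_m,\quad \mathcal{F}_3=P_{\boldsymbol{\alpha}}(s)(\mathcal{L}+\mathcal{F})-S_{\boldsymbol{\alpha}}^{s}\mathcal{I}_m,$$ $$\mathcal{E}_4=\mathcal{I}_m,\quad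 \mathcal{F}_4=P_{\boldsymbol{\beta}}(k)(\mathcal{L}+\mathcal{F})-K_{\boldsymbol{\beta}}^{k}\mathcal{I}_m,$$ are convergent. (b) Let $s=k=1$, $\alpha_i\in[0,1]$ $(i=1,\dots,n-1)$ and $\beta_j\in[0,1]$ $(j=2,\dots,n)$. If moreover $$0<\alpha_1a_{12\dots2}\,a_{21\dots1}<1,$$ $$0<\alpha_i a_{i(i+1)\dots(i+1)}a_{(i+1)i\dots i}+\beta_i a_{i(i-1)\dots(i-1)}a_{(i-1)i\dots i}<1,\quad i=2,\dots,n-1,$$ $$0<\beta_n a_{n(n-1)\dots(n-1)}a_{(n-1)n\dots n}<1,$$ then the splitting $\mathcal{A}_{\boldsymbol{\alpha}\boldsymbol{\beta}}(1,1)=\mathcal{E}_5-\mathcal{F}_5$ is convergent, where $$\mathcal{E}_5=(I-S_{\boldsymbol{\alpha}}K-K_{\boldsymbol{\beta}}S)\mathcal{I}_m,\quad \mathcal{F}_5=\mathcal{L}+\mathcal{F}-(S_{\boldsymbol{\alpha}}+K_{\boldsymbol{\beta}})\mathcal{I}_m+S_{\boldsymbol{\alpha}}(\mathcal{L}'+\mathcal{F})+K_{\boldsymbol{\beta}}(\mathcal{L}+\mathcal{F}').$$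
   Context: $\mathbb{R}^{[m,n]}$ is the set of real tensors $(a_{i_1\dots i_m})$ of order $m$ and dimension $n$ (all indices in $\{1,\dots,n\}$). For $\mathbf{x}\in\mathbb{C}^n$, $(\mathcal{A}\mathbf{x}^{m-1})_i=\sum_{i_2,\dots,i_m=1}^n a_{ii_2\dots i_m}x_{i_2}\cdots x_{i_m}$, and $\mathbf{x}^{[m-1]}=(x_1^{m-1},\dots,x_n^{m-1})^T$. An eigenvalue of $\mathcal{A}$ is $\lambda\in\mathbb{C}$ such that $\mathcal{A}\mathbf{x}^{m-1}=\lambda\mathbf{x}^{[m-1]}$ for some $\mathbf{x}\in\mathbb{C}^n\setminus\{0\}$; $\rho(\mathcal{A})$ is the maximum modulus of the eigenvalues. The identity tensor $\mathcal{I}_m$ has entries $1$ when all indices coincide and $0$ otherwise; $I$ is the $n\times n$ identity matrix. $\mathcal{A}$ is a strong $\mathcal{M}$-tensor if $\mathcal{A}=\eta\mathcal{I}_m-\mathcal{B}$ for an entrywise nonnegative tensor $\mathcal{B}$ and a real $\eta>0$ with $\eta>\rho(\mathcal{B})$. For an $n\times n$ matrix $A$ and $\mathcal{B}\in\mathbb{R}^{[m,n]}$, the product $A\mathcal{B}\in\mathbb{R}^{[m,n]}$ is $(A\mathcal{B})_{ji_2\dots i_m}=\sum_{l=1}^n A_{jl}\,b_{l i_2\dots i_m}$. The majorization matrix $M(\mathcal{A})$ is the $n\times n$ matrix with entries $M(\mathcal{A})_{ij}=a_{ij\dots j}$. A tensor $\mathcal{E}$ is left-nonsingular if $M(\mathcal{E})$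 is nonsingular and $\mathcal{E}=M(\mathcal{E})\mathcal{I}_m$. $\mathcal{C}=\mathcal{E}-\mathcal{G}$ is a splitting of $\mathcal{C}$ if $\mathcal{E}$ is left-nonsingular; the splitting is convergent if $\rho(M(\mathcal{E})^{-1}\mathcal{G})<1$. Write $\mathcal{A}=\mathcal{I}_m-\mathcal{L}-\mathcal{F}$, where $\mathcal{L}=L\mathcal{I}_m$, $-L$ is the strictly lower triangular part of $M(\mathcal{A})$, and $\mathcal{F}=\mathcal{I}_m-\mathcal{L}-\mathcal{A}$. $S_{\boldsymbol{\alpha}}^{s}$ and $K_{\boldsymbol{\beta}}^{k}$ are $n\times n$ matrices ($s$ and $k$ are superscripts, not powers). The only possibly nonzero entries of $S_{\boldsymbol{\alpha}}^{s}$ are $(S_{\boldsymbol{\alpha}}^{s})_{i,i+s}=-\alpha_i a_{i(i+s)\dots(i+s)}$ for $i=1,\dots,n-s$. The only possibly nonzero entries of $K_{\boldsymbol{\beta}}^{k}$ are $(K_{\boldsymbol{\beta}}^{k})_{j,j-k}=-\beta_j a_{j(j-k)\dots(j-k)}$ for $j=k+1,\dots,n$. Put $P_{\boldsymbol{\alpha}\boldsymbol{\beta}}(s,k)=I+S_{\boldsymbol{\alpha}}^{s}+K_{\boldsymbol{\beta}}^{k}$, $P_{\boldsymbol{\alpha}}(s)=I+S_{\boldsymbol{\alpha}}^{s}$, $P_{\boldsymbol{\beta}}(k)=I+K_{\boldsymbol{\beta}}^{k}$, and $\mathcal{A}_{\boldsymbol{\alpha}\boldsymbol{\beta}}(s,k)=P_{\boldsymbol{\alpha}\boldsymbol{\beta}}(s,k)\mathcal{A}$,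 $\mathcal{A}_{\boldsymbol{\alpha}}(s)=P_{\boldsymbol{\alpha}}(s)\mathcal{A}$, $\mathcal{A}_{\boldsymbol{\beta}}(k)=P_{\boldsymbol{\beta}}(k)\mathcal{A}$. For $s=k=1$ write $S_{\boldsymbol{\alpha}}=S_{\boldsymbol{\alpha}}^{1}$ and $K_{\boldsymbol{\beta}}=K_{\boldsymbol{\beta}}^{1}$; $S$ (resp. $K$) denotes $S_{\boldsymbol{\alpha}}$ (resp. $K_{\boldsymbol{\beta}}$) with all $\alpha_i=1$ (resp. all $\beta_j=1$). The tensors $\mathcal{L}',\mathcal{F}'$ are defined by $\mathcal{L}=K\mathcal{I}_m+\mathcal{L}'$ and $\mathcal{F}=S\mathcal{I}_m+\mathcal{F}'$. *)

theory Defs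
  imports
    "HOL-Library.Function_Algebras"
    "Jordan_Normal_Form.Gauss_Jordan_Elimination"
    Complex_Main
begin

text \<open>
  All indices are shifted to start at 0: the index set 1, ..., n becomes 0, ..., n - 1,
  as for matrices and vectors in the library.

  A tensor of order m and dimension n is a function on index lists of length m with entries
  below n, extended by 0 to all other lists. Hence equality, addition and subtraction of tensors
  are those of functions.
\<close>

type_synonym tensor = "nat list \<Rightarrow> real"

definition tensor_idx :: "nat \<Rightarrow> nat \<Rightarrow> nat list set" where
  "tensor_idx m n = {is. length is = m \<and> set is \<subseteq> {..<n}}"

definition carrier_tensor :: "nat \<Rightarrow> nat \<Rightarrow> tensor set" where
  "carrier_tensor m n = {\<A>. \<forall>is. is \<notin> tensor_idx m n \<longrightarrow> \<A> is = 0}"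

definition nonneg_tensor :: "tensor \<Rightarrow> bool" where
  "nonneg_tensor \<A> \<longleftrightarrow> (\<forall>is. 0 \<le> \<A> is)"

definition smult_tensor :: "real \<Rightarrow> tensor \<Rightarrow> tensor" (infixl "\<cdot>\<^sub>t" 70) where
  "c \<cdot>\<^sub>t \<A> = (\<lambda>is. c * \<A> is)"

definition id_tensor :: "nat \<Rightarrow> nat \<Rightarrow> tensor" where
  "id_tensor m n is = (if \<exists>i<n. is = replicate m i then 1 else 0)"

definition mat_mult_tensor :: "real mat \<Rightarrow> tensor \<Rightarrow> tensor" (infixl "*\<^sub>t" 70) where
  "(A *\<^sub>t \<B>) is = (case is of
      [] \<Rightarrow> 0
    | j # js \<Rightarrow> if j < dim_row A then \<Sum>l<dim_col A. A $$ (j, l) * \<B> (l # js) else 0)"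


definition tensor_apply :: "nat \<Rightarrow> nat \<Rightarrow> tensor \<Rightarrow> complex vec \<Rightarrow> complex vec" where
  "tensor_apply m n \<A> x = vec n (\<lambda>i.
     \<Sum>js\<in>tensor_idx (m - 1) n. complex_of_real (\<A> (i # js)) * (\<Prod>j\<leftarrow>js. x $ j))"

definition tensor_eigenvalue :: "nat \<Rightarrow> nat \<Rightarrow> tensor \<Rightarrow> complex \<Rightarrow> bool" where
  "tensor_eigenvalue m n \<A> \<mu> \<longleftrightarrow>
     (\<exists>x\<in>carrier_vec n. x \<noteq> 0\<^sub>v n \<and> tensor_apply m n \<A> x = \<mu> \<cdot>\<^sub>v map_vec (\<lambda>z. z ^ (m - 1)) x)"

text \<open>
  The maximum is taken with \<open>GREATEST\<close> rather than \<open>Max\<close>, so that finiteness of the set of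
  eigenvalues plays no role.
\<close>

definition tensor_spectral_radius :: "nat \<Rightarrow> nat \<Rightarrow> tensor \<Rightarrow> real" where
  "tensor_spectral_radius m n \<A> = (GREATEST r. \<exists>\<mu>. tensor_eigenvalue m n \<A> \<mu> \<and> r = cmod \<mu>)"

definition strong_M_tensor :: "nat \<Rightarrow> nat \<Rightarrow> tensor \<Rightarrow> bool" where
  "strong_M_tensor m n \<A> \<longleftrightarrow>
     (\<exists>\<eta> \<B>. \<B> \<in> carrier_tensor m n \<and> nonneg_tensor \<B> \<and> 0 < \<eta> \<and>
        tensor_spectral_radius m n \<B> < \<eta> \<and> \<A> = \<eta> \<cdot>\<^sub>t id_tensor m n - \<B>)"


definition majorization_mat :: "nat \<Rightarrow> nat \<Rightarrow> tensor \<Rightarrow> real mat" where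
  "majorization_mat m n \<A> = mat n n (\<lambda>(i, j). \<A> (i # replicate (m - 1) j))"

definition left_nonsingular :: "nat \<Rightarrow> nat \<Rightarrow> tensor \<Rightarrow> bool" where
  "left_nonsingular m n \<E> \<longleftrightarrow>
     invertible_mat (majorization_mat m n \<E>) \<and> \<E> = majorization_mat m n \<E> *\<^sub>t id_tensor m n"

definition is_splitting :: "nat \<Rightarrow> nat \<Rightarrow> tensor \<Rightarrow> tensor \<Rightarrow> tensor \<Rightarrow> bool" where
  "is_splitting m n \<C> \<E> \<G> \<longleftrightarrow>
     \<E> \<in> carrier_tensor m n \<and> \<G> \<in> carrier_tensor m n \<and> \<C> = \<E> - \<G> \<and> left_nonsingular m n \<E>"

definition convergent_splitting :: "nat \<Rightarrow> nat \<Rightarrow> tensor \<Rightarrow> tensor \<Rightarrow> tensor \<Rightarrow> bool" where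
  "convergent_splitting m n \<C> \<E> \<G> \<longleftrightarrow>
     is_splitting m n \<C> \<E> \<G> \<and>
     tensor_spectral_radius m n (the (mat_inverse (majorization_mat m n \<E>)) *\<^sub>t \<G>) < 1"


definition lower_mat :: "nat \<Rightarrow> nat \<Rightarrow> tensor \<Rightarrow> real mat" where
  "lower_mat m n \<A> =
     mat n n (\<lambda>(i, j). if j < i then - majorization_mat m n \<A> $$ (i, j) else 0)"

definition lower_tensor :: "nat \<Rightarrow> nat \<Rightarrow> tensor \<Rightarrow> tensor" where
  "lower_tensor m n \<A> = lower_mat m n \<A> *\<^sub>t id_tensor m n"

definition rest_tensor :: "nat \<Rightarrow> nat \<Rightarrow> tensor \<Rightarrow> tensor" where
  "rest_tensor m n \<A> = id_tensor m n - lower_tensor m n \<A> - \<A>"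

definition S_mat :: "nat \<Rightarrow> nat \<Rightarrow> tensor \<Rightarrow> nat \<Rightarrow> (nat \<Rightarrow> real) \<Rightarrow> real mat" where
  "S_mat m n \<A> s \<alpha> =
     mat n n (\<lambda>(i, j). if j = i + s then - \<alpha> i * \<A> (i # replicate (m - 1) j) else 0)"

definition K_mat :: "nat \<Rightarrow> nat \<Rightarrow> tensor \<Rightarrow> nat \<Rightarrow> (nat \<Rightarrow> real) \<Rightarrow> real mat" where
  "K_mat m n \<A> k \<beta> =
     mat n n (\<lambda>(i, j). if i = j + k then - \<beta> i * \<A> (i # replicate (m - 1) j) else 0)"

text \<open>The tensors \<open>\<L>'\<close> and \<open>\<F>'\<close> with \<open>\<L> = K \<I> + \<L>'\<close> and \<open>\<F> = S \<I> + \<F>'\<close>,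
  where \<open>K\<close> and \<open>S\<close> have step 1 and all parameters equal to 1.\<close>

definition lower_tensor' :: "nat \<Rightarrow> nat \<Rightarrow> tensor \<Rightarrow> tensor" where
  "lower_tensor' m n \<A> = lower_tensor m n \<A> - K_mat m n \<A> 1 (\<lambda>_. 1) *\<^sub>t id_tensor m n"

definition rest_tensor' :: "nat \<Rightarrow> nat \<Rightarrow> tensor \<Rightarrow> tensor" where
  "rest_tensor' m n \<A> = rest_tensor m n \<A> - S_mat m n \<A> 1 (\<lambda>_. 1) *\<^sub>t id_tensor m n"

end

theory Submission
  imports Defs "HOL-Analysis.Function_Topology" "Jordan_Normal_Form.Determinant"
begin

text \<open>
  By Perron--Frobenius theory, a nonnegative tensor \<open>\<B>\<close> has \<open>\<rho>(\<B>) < \<eta>\<close> if and only if some entrywise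
  positive \<open>x\<close> satisfies \<open>\<B> x\<^sup>m\<^sup>-\<^sup>1 < \<eta> x\<^sup>[\<^sup>m\<^sup>-\<^sup>1\<^sup>]\<close>. A strong M-tensor \<open>\<A>\<close> therefore has a positive \<open>x\<close> with
  \<open>\<A> x\<^sup>m\<^sup>-\<^sup>1 > 0\<close>, and since the preconditioner \<open>P\<close> is nonnegative with unit diagonal, also
  \<open>(P \<A>) x\<^sup>m\<^sup>-\<^sup>1 > 0\<close>. Every splitting in question has a nonnegative iteration tensor
  \<open>\<I> - M(\<E>)\<^sup>-\<^sup>1 P \<A>\<close>, so the same \<open>x\<close> certifies that its spectral radius is below 1.
  Since \<open>tensor_spectral_radius\<close> is defined by \<open>GREATEST\<close>, an eigenvalue of largest modulus has to be
  exhibited. It is the power \<open>m - 1\<close> of the largest \<open>r\<close> with \<open>r x \<le> g x\<close> for some nonzero \<open>x \<ge> 0\<close>, where \<open>g\<close> is the map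
  \<open>x \<mapsto> (\<B> x\<^sup>m\<^sup>-\<^sup>1)\<^sup>[\<^sup>1\<^sup>/\<^sup>(\<^sup>m\<^sup>-\<^sup>1\<^sup>)\<^sup>]\<close>; an eigenvector is obtained first for the strictly increasing
  perturbations of \<open>g\<close> by \<open>\<epsilon> \<Sum>x\<^sub>j\<close>, and then by compactness for \<open>\<epsilon> = 0\<close>.
\<close>

subsection \<open>Homogeneous monotone maps\<close>

text \<open>Vectors are total functions on the naturals. Pinning the coordinates from
  \<open>n\<close> on to 0 confines the simplex to a product of unit intervals, so that Tychonoff's
  theorem gives compactness.\<close>

definition prob_simplex :: "nat \<Rightarrow> (nat \<Rightarrow> real) set" where
  "prob_simplex n = {x. (\<forall>i. 0 \<le> x i) \<and> (\<forall>i\<ge>n. x i = 0) \<and> (\<Sum>i<n. x i) = 1}"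

lemma compact_prob_simplex: "compact (prob_simplex n)"
proof -
  have "compactin (product_topology (\<lambda>i::nat. euclidean :: real topology) UNIV)
          (PiE UNIV (\<lambda>_. {0..1}))"
    by (simp add: compactin_PiE)
  hence cube: "compact (PiE UNIV (\<lambda>_::nat. {0..1::real}))"
    by (simp add: euclidean_product_topology)
  have "closed {x :: nat \<Rightarrow> real. (\<forall>i. 0 \<le> x i) \<and> (\<forall>i. i \<ge> n \<longrightarrow> x i = 0) \<and> (\<Sum>i<n. x i) = 1}"
    by (intro closed_Collect_conj closed_Collect_all closed_Collect_imp closed_Collect_le
        closed_Collect_eq continuous_intros open_Collect_const) auto
  hence closed: "closed (prob_simplex n)"
    by (simp add: prob_simplex_def)
  have "x i \<le> 1" if "x \<in> prob_simplex n" for x i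
  proof (cases "i < n")
    case True
    then have "x i \<le> (\<Sum>i<n. x i)"
      using that by (intro member_le_sum) (auto simp: prob_simplex_def)
    then show ?thesis using that by (simp add: prob_simplex_def)
  qed (use that in \<open>auto simp: prob_simplex_def\<close>)
  then have "prob_simplex n \<subseteq> PiE UNIV (\<lambda>_::nat. {0..1::real})"
    by (auto simp: prob_simplex_def)
  with cube closed show ?thesis
    by (metis compact_Int_closed inf.absorb2)
qed

lemma prob_simplex_pos_coordinate:
  assumes "x \<in> prob_simplex n"
  shows "\<exists>i<n. 0 < x i"
proof (rule ccontr)
  assume "\<not> ?thesis"
  then have "(\<Sum>i<n. x i) = 0"
    using assms by (intro sum.neutral) (auto simp: prob_simplex_def not_less antisym)
  with assms show False by (simp add: prob_simplex_def)
qed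

text \<open>Isolates what the Perron--Frobenius argument needs of a tensor, so that it can be run
  both for the tensor and for its perturbations, which need not come from tensors. Order and scaling
  matter on nonnegative vectors only; continuity everywhere makes the solution sets below
  closed.\<close>

locale homogeneous_monotone =
  fixes n :: nat and g :: "(nat \<Rightarrow> real) \<Rightarrow> nat \<Rightarrow> real"
  assumes n_pos: "0 < n"
    and mono: "\<lbrakk>\<And>j. j < n \<Longrightarrow> 0 \<le> x j; \<And>j. j < n \<Longrightarrow> x j \<le> y j; i < n\<rbrakk> \<Longrightarrow> g x i \<le> g y i"
    and homogeneous: "\<lbrakk>0 \<le> c; \<And>j. j < n \<Longrightarrow> 0 \<le> x j; i < n\<rbrakk> \<Longrightarrow> g (\<lambda>j. c * x j) i = c * g x i"
    and continuous: "i < n \<Longrightarrow> continuous_on UNIV (\<lambda>x. g x i)"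
begin

lemma nonneg:
  assumes "\<And>j. j < n \<Longrightarrow> 0 \<le> x j" "i < n"
  shows "0 \<le> g x i"
proof -
  \<comment> \<open>Homogeneity with factor 0 makes \<open>g\<close> vanish at the zero vector,
    which is the lower end of the monotonicity estimate.\<close>
  have "g (\<lambda>j. 0 * x j) i \<le> g x i"
    using assms by (intro mono) auto
  then show ?thesis
    using homogeneous[of 0 x i] assms by simp
qed

text \<open>Monotonicity in both directions shows that \<open>g\<close> ignores the coordinates from
  \<open>n\<close> on, which normalisation sets to 0.\<close>

lemma cong:
  assumes "\<And>j. j < n \<Longrightarrow> 0 \<le> x j" "\<And>j. j < n \<Longrightarrow> x j = y j" "i < n"
  shows "g x i = g y i"
  using assms by (intro antisym mono) auto

lemma continuous_on_component [continuous_intros]: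
  assumes "i < n" "continuous_on X h"
  shows "continuous_on X (\<lambda>w. g (h w) i)"
  using continuous_on_compose2[OF continuous[OF assms(1)] assms(2)] by auto

text \<open>The Collatz--Wielandt condition; the largest admissible \<open>r\<close> plays the part
  of the Perron root.\<close>

definition subeigen :: "real \<Rightarrow> (nat \<Rightarrow> real) \<Rightarrow> bool" where
  "subeigen r x \<longleftrightarrow> (\<forall>i<n. 0 \<le> x i) \<and> (\<exists>i<n. 0 < x i) \<and> (\<forall>i<n. r * x i \<le> g x i)"

lemma subeigen_normalise:
  assumes "subeigen r y"
  obtains x where "x \<in> prob_simplex n" "\<forall>i<n. r * x i \<le> g x i"
proof -
  define t where "t = (\<Sum>i<n. y i)"
  define x where "x = (\<lambda>i. if i < n then 1 / t * y i else 0)"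
  have y: "\<And>i. i < n \<Longrightarrow> 0 \<le> y i" "\<And>i. i < n \<Longrightarrow> r * y i \<le> g y i"
    using assms by (auto simp: subeigen_def)
  obtain k where "k < n" "0 < y k"
    using assms by (auto simp: subeigen_def)
  then have t: "t > 0"
    unfolding t_def using y(1) by (intro sum_pos2[of _ k]) auto
  have "(\<Sum>i<n. x i) = (\<Sum>i<n. y i / t)"
    by (intro sum.cong) (auto simp: x_def)
  also have "\<dots> = 1"
    using t by (simp add: sum_divide_distrib[symmetric] t_def[symmetric])
  finally have "x \<in> prob_simplex n"
    using y(1) t by (auto simp: prob_simplex_def x_def)
  moreover have "r * x i \<le> g x i" if "i < n" for i
  proof -
    have "g x i = g (\<lambda>j. 1 / t * y j) i"
      using that t y(1) by (intro cong) (auto simp: x_def)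
    also have "\<dots> = 1 / t * g y i"
      using that t y(1) by (intro homogeneous) auto
    finally show ?thesis
      using y(2)[OF that] t that by (simp add: x_def divide_right_mono)
  qed
  ultimately show ?thesis using that by blast
qed

lemma subeigen_simplex:
  assumes "x \<in> prob_simplex n" "\<forall>i<n. r * x i \<le> g x i"
  shows "subeigen r x"
  using assms prob_simplex_pos_coordinate[OF assms(1)]
  by (auto simp: subeigen_def prob_simplex_def)

definition bound :: real where
  "bound = (\<Sum>i<n. g (\<lambda>_. 1) i)"

text \<open>After normalisation all coordinates are at most 1 and sum to 1, so adding up the
  inequalities over \<open>i\<close> leaves \<open>r\<close> on the left and at most
  \<open>bound\<close> on the right.\<close>

lemma subeigen_le_bound:
  assumes "subeigen r y"
  shows "r \<le> bound"
proof -
  obtain x where x: "x \<in> prob_simplex n" "\<forall>i<n. r * x i \<le> g x i"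
    using subeigen_normalise[OF assms] .
  have le1: "x j \<le> 1" if "j < n" for j
  proof -
    have "x j \<le> (\<Sum>i<n. x i)"
      using that x by (intro member_le_sum) (auto simp: prob_simplex_def)
    then show ?thesis using x by (simp add: prob_simplex_def)
  qed
  have "r = (\<Sum>i<n. r * x i)"
    using x by (simp add: prob_simplex_def sum_distrib_left[symmetric])
  also have "\<dots> \<le> (\<Sum>i<n. g (\<lambda>_. 1) i)"
  proof (rule sum_mono)
    fix i assume "i \<in> {..<n}"
    then have "g x i \<le> g (\<lambda>_. 1) i"
      using x le1 by (intro mono) (auto simp: prob_simplex_def)
    then show "r * x i \<le> g (\<lambda>_. 1) i"
      using x \<open>i \<in> {..<n}\<close> by force
  qed
  finally show ?thesis by (simp add: bound_def)
qed

lemma maximal_subeigen: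
  obtains r x where "0 \<le> r" "x \<in> prob_simplex n" "\<forall>i<n. r * x i \<le> g x i"
    "\<And>r' y. subeigen r' y \<Longrightarrow> r' \<le> r"
proof -
  \<comment> \<open>Pairs of a factor and a normalised subeigenvector. This set is compact, so the
    factor attains its maximum on it.\<close>
  define W where "W = ({0..bound} \<times> prob_simplex n) \<inter> (\<Inter>i\<in>{..<n}. {p. fst p * snd p i \<le> g (snd p) i})"
  have [continuous_intros]: "continuous_on UNIV (\<lambda>p :: real \<times> (nat \<Rightarrow> real). snd p i)" for i
    by (rule continuous_on_product_then_coordinatewise[OF continuous_on_snd[OF continuous_on_id]])
  have "closed (\<Inter>i\<in>{..<n}. {p :: real \<times> (nat \<Rightarrow> real). fst p * snd p i \<le> g (snd p) i})"
    by (intro closed_INT ballI closed_Collect_le continuous_intros) auto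
  then have "compact W"
    unfolding W_def by (intro compact_Int_closed compact_Times compact_prob_simplex compact_Icc)
  \<comment> \<open>Negative factors are lifted to 0, which stays admissible because
    \<open>g x\<close> is nonnegative; thus \<open>W\<close> sees competitors of either
    sign.\<close>
  have sub: "(max 0 r, x) \<in> W" if "x \<in> prob_simplex n" "\<forall>i<n. r * x i \<le> g x i" for r x
  proof -
    have "\<forall>i<n. max 0 r * x i \<le> g x i"
      using that nonneg[of x] by (auto simp: prob_simplex_def max_def)
    then show ?thesis
      using that subeigen_le_bound[OF subeigen_simplex, of x "max 0 r"] by (auto simp: W_def)
  qed
  have "subeigen 0 (\<lambda>_. 1)"
    using n_pos nonneg[of "\<lambda>_. 1"] by (auto simp: subeigen_def)
  then obtain x0 where "x0 \<in> prob_simplex n" "\<forall>i<n. 0 * x0 i \<le> g x0 i"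
    by (rule subeigen_normalise)
  then have "W \<noteq> {}" using sub by blast
  moreover have "continuous_on W fst" by (intro continuous_intros)
  ultimately obtain p where p: "p \<in> W" "\<And>q. q \<in> W \<Longrightarrow> fst q \<le> fst p"
    using continuous_attains_sup[OF \<open>compact W\<close>, of fst] by blast
  show ?thesis
  proof
    show "0 \<le> fst p" "snd p \<in> prob_simplex n" "\<forall>i<n. fst p * snd p i \<le> g (snd p) i"
      using p(1) by (auto simp: W_def)
    fix r' y assume "subeigen r' y"
    then obtain x where "x \<in> prob_simplex n" "\<forall>i<n. r' * x i \<le> g x i"
      by (rule subeigen_normalise)
    from p(2)[OF sub[OF this]] show "r' \<le> fst p" by simp
  qed
qed

definition radius :: real where
  "radius = (THE r. (\<exists>x. subeigen r x) \<and> (\<forall>r' y. subeigen r' y \<longrightarrow> r' \<le> r))"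

lemma radius:
  shows radius_nonneg: "0 \<le> radius"
    and radius_attained: "\<exists>x\<in>prob_simplex n. \<forall>i<n. radius * x i \<le> g x i"
    and subeigen_le_radius: "subeigen r' y \<Longrightarrow> r' \<le> radius"
proof -
  obtain r x where r: "0 \<le> r" "x \<in> prob_simplex n" "\<forall>i<n. r * x i \<le> g x i"
    "\<And>r' y. subeigen r' y \<Longrightarrow> r' \<le> r"
    using maximal_subeigen by blast
  have "radius = r"
    unfolding radius_def using r subeigen_simplex by (intro the_equality) (blast intro: antisym)+
  with r show "0 \<le> radius" "\<exists>x\<in>prob_simplex n. \<forall>i<n. radius * x i \<le> g x i"
    "subeigen r' y \<Longrightarrow> r' \<le> radius" by auto
qed

text \<open>Let \<open>y\<close> be a subeigenvector for \<open>radius\<close> and enlarge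
  \<open>x\<close> until it lies above \<open>y\<close> and touches it at some \<open>k\<close>.
  Monotonicity and homogeneity at \<open>k\<close> then compare \<open>radius\<close> with
  \<eta>.\<close>

lemma radius_less:
  assumes x: "\<And>i. i < n \<Longrightarrow> 0 < x i" "\<And>i. i < n \<Longrightarrow> g x i < \<eta> * x i"
  shows "radius < \<eta>"
proof -
  obtain y where y: "y \<in> prob_simplex n" "\<forall>i<n. radius * y i \<le> g y i"
    using radius_attained by blast
  \<comment> \<open>The least factor with y \<le> t x, attained at \<open>k\<close>.\<close>
  define t where "t = Max ((\<lambda>i. y i / x i) ` {..<n})"
  have "t \<in> (\<lambda>i. y i / x i) ` {..<n}"
    unfolding t_def using n_pos by (intro Max_in) auto
  then obtain k where k: "k < n" "t = y k / x k" by auto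
  have le: "y i \<le> t * x i" if "i < n" for i
  proof -
    have "y i / x i \<le> t" unfolding t_def using that by (intro Max_ge) auto
    then show ?thesis using x(1)[OF that] by (simp add: field_simps)
  qed
  have nn: "\<And>i. 0 \<le> y i" using y by (auto simp: prob_simplex_def)
  obtain l where l: "l < n" "0 < y l" using prob_simplex_pos_coordinate[OF y(1)] by blast
  have "0 < t * x l" using le[OF l(1)] l by simp
  then have "0 < t" using x(1)[OF l(1)] by (simp add: zero_less_mult_iff)
  then have yk: "y k = t * x k" "0 < y k" using k x(1)[OF k(1)] by (auto simp: field_simps)
  have "radius * y k \<le> g y k" using y k by blast
  also have "\<dots> \<le> g (\<lambda>j. t * x j) k" using nn le k by (intro mono) auto
  also have "\<dots> = t * g x k" using \<open>0 < t\<close> x k by (intro homogeneous) (auto intro: less_imp_le)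
  also have "\<dots> < t * (\<eta> * x k)" using x(2)[OF k(1)] \<open>0 < t\<close> by simp
  also have "\<dots> = \<eta> * y k" using yk by simp
  finally show ?thesis using yk(2) by simp
qed

text \<open>If equality failed somewhere for the maximiser \<open>x\<close>, then \<open>g x\<close> would be a strict subeigenvector.\<close>

lemma positive_eigenvector:
  assumes strict: "\<And>x y i. \<lbrakk>\<And>j. j < n \<Longrightarrow> 0 \<le> x j; \<And>j. j < n \<Longrightarrow> x j \<le> y j;
      \<exists>j<n. x j < y j; i < n\<rbrakk> \<Longrightarrow> g x i < g y i"
  obtains x where "x \<in> prob_simplex n" "\<forall>i<n. 0 < x i" "\<forall>i<n. g x i = radius * x i"
proof -
  obtain x where x: "x \<in> prob_simplex n" "\<forall>i<n. radius * x i \<le> g x i"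
    using radius_attained by blast
  have nn: "\<And>i. 0 \<le> x i" using x by (auto simp: prob_simplex_def)
  have pos: "0 < g x i" if "i < n" for i
  proof -
    \<comment> \<open>The zero vector lies strictly below \<open>x\<close> in some coordinate, and
      strictness carries this to every coordinate of \<open>g x\<close>.\<close>
    have "g (\<lambda>j. 0 * x j) i < g x i"
      using that nn prob_simplex_pos_coordinate[OF x(1)] by (intro strict) auto
    then show ?thesis using homogeneous[of 0 x i] that nn by simp
  qed
  have eq: "g x i = radius * x i" if "i < n" for i
  proof (rule ccontr)
    assume "g x i \<noteq> radius * x i"
    then have i: "radius * x i < g x i" using x that by force
    \<comment> \<open>The largest factor for which \<open>g x\<close> is a subeigenvector.\<close>
    define t where "t = Min ((\<lambda>j. g (g x) j / g x j) ` {..<n})"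
    have "t \<in> (\<lambda>j. g (g x) j / g x j) ` {..<n}"
      unfolding t_def using n_pos by (intro Min_in) auto
    then obtain k where k: "k < n" "t = g (g x) k / g x k" by auto
    have "radius * g x k = g (\<lambda>j. radius * x j) k"
      using radius_nonneg nn k by (intro homogeneous[symmetric]) auto
    \<comment> \<open>The strict gap at the single coordinate \<open>i\<close> becomes a strict gap
      at \<open>k\<close>, wherever the minimum is attained.\<close>
    also have "\<dots> < g (g x) k"
      using radius_nonneg nn k x i that by (intro strict) auto
    finally have "radius < t" using k pos[OF k(1)] by (simp add: pos_less_divide_eq)
    moreover have "subeigen t (g x)"
    proof -
      have "t * g x j \<le> g (g x) j" if "j < n" for j
      proof -
        have "t \<le> g (g x) j / g x j" unfolding t_def using that by (intro Min_le) auto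
        then show ?thesis using pos[OF that] by (simp add: field_simps)
      qed
      then show ?thesis using pos n_pos by (auto simp: subeigen_def intro: less_imp_le)
    qed
    ultimately show False using subeigen_le_radius by force
  qed
  have "0 < x i" if "i < n" for i
    using pos[OF that] eq[OF that] nn[of i] radius_nonneg by (simp add: zero_less_mult_iff)
  with x eq that show ?thesis by blast
qed

section \<open>Perturbation to strictly increasing maps, and the limit\<close>

definition perturb :: "real \<Rightarrow> (nat \<Rightarrow> real) \<Rightarrow> nat \<Rightarrow> real" where
  "perturb \<epsilon> x i = g x i + \<epsilon> * (\<Sum>j<n. x j)"

lemma homogeneous_monotone_perturb:
  assumes "0 \<le> \<epsilon>"
  shows "homogeneous_monotone n (perturb \<epsilon>)"
proof
  fix x y :: "nat \<Rightarrow> real" and i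
  assume *: "\<And>j. j < n \<Longrightarrow> 0 \<le> x j" "\<And>j. j < n \<Longrightarrow> x j \<le> y j" "i < n"
  then have "g x i \<le> g y i" "(\<Sum>j<n. x j) \<le> (\<Sum>j<n. y j)"
    by (auto intro: mono sum_mono)
  with assms show "perturb \<epsilon> x i \<le> perturb \<epsilon> y i"
    by (simp add: perturb_def add_mono mult_left_mono)
next
  fix c :: real and x :: "nat \<Rightarrow> real" and i
  assume "0 \<le> c" "\<And>j. j < n \<Longrightarrow> 0 \<le> x j" "i < n"
  then show "perturb \<epsilon> (\<lambda>j. c * x j) i = c * perturb \<epsilon> x i"
    by (simp add: perturb_def homogeneous sum_distrib_left[symmetric] algebra_simps)
next
  fix i assume "i < n"
  then show "continuous_on UNIV (\<lambda>x. perturb \<epsilon> x i)"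
    unfolding perturb_def by (intro continuous_intros continuous) auto
qed (rule n_pos)

text \<open>The added multiple of the coordinate sum grows strictly as soon as one coordinate does,
  so the strictness required by \<open>positive_eigenvector\<close> holds.\<close>

lemma perturb_positive_eigenvector:
  assumes "0 < \<epsilon>"
  obtains x where "x \<in> prob_simplex n" "\<forall>i<n. 0 < x i"
    "\<forall>i<n. perturb \<epsilon> x i = homogeneous_monotone.radius n (perturb \<epsilon>) * x i"
proof (rule homogeneous_monotone.positive_eigenvector[OF homogeneous_monotone_perturb])
  fix x y :: "nat \<Rightarrow> real" and i
  assume *: "\<And>j. j < n \<Longrightarrow> 0 \<le> x j" "\<And>j. j < n \<Longrightarrow> x j \<le> y j" "\<exists>j<n. x j < y j" "i < n"
  then have "g x i \<le> g y i" by (intro mono) auto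
  moreover have "(\<Sum>j<n. x j) < (\<Sum>j<n. y j)"
    using * by (intro sum_strict_mono_ex1) auto
  ultimately show "perturb \<epsilon> x i < perturb \<epsilon> y i"
    using assms by (simp add: perturb_def add_le_less_mono)
qed (use assms that in auto)

text \<open>On nonnegative vectors the perturbation only increases \<open>g\<close>, hence a
  subeigenvector of \<open>g\<close> remains one for the same factor.\<close>

lemma radius_le_perturb:
  assumes "0 \<le> \<epsilon>"
  shows "radius \<le> homogeneous_monotone.radius n (perturb \<epsilon>)"
proof -
  interpret p: homogeneous_monotone n "perturb \<epsilon>"
    using assms by (rule homogeneous_monotone_perturb)
  obtain x where x: "x \<in> prob_simplex n" "\<forall>i<n. radius * x i \<le> g x i"
    using radius_attained by blast
  have "\<forall>i<n. radius * x i \<le> perturb \<epsilon> x i"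
    using x assms by (auto simp: perturb_def prob_simplex_def intro: add_increasing2)
  with x(1) show ?thesis by (intro p.subeigen_le_radius p.subeigen_simplex)
qed

text \<open>Let \<open>\<epsilon>\<close> tend to 0: the triples \<open>(\<epsilon>, r, x)\<close> form a compact set, on which the smallest
  \<open>\<epsilon>\<close> is attained.\<close>

lemma eigenvector_limit:
  assumes ge: "\<And>\<epsilon>. 0 < \<epsilon> \<Longrightarrow> \<eta> \<le> homogeneous_monotone.radius n (perturb \<epsilon>)"
  obtains r x where "\<eta> \<le> r" "x \<in> prob_simplex n" "\<forall>i<n. g x i = r * x i"
proof -
  \<comment> \<open>An upper bound for the radii of all perturbations with \<epsilon> \<le> 1, which
    keeps the eigenvalue component of \<open>W\<close> in a compact interval.\<close>
  define R where "R = bound + n"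
  define W where "W = ({0..1} \<times> {\<eta>..R} \<times> prob_simplex n) \<inter>
    (\<Inter>i\<in>{..<n}. {p. perturb (fst p) (snd (snd p)) i = fst (snd p) * snd (snd p) i})"
  have [continuous_intros]:
    "continuous_on UNIV (\<lambda>p :: real \<times> real \<times> (nat \<Rightarrow> real). snd (snd p) i)" for i
    by (rule continuous_on_product_then_coordinatewise
        [OF continuous_on_snd[OF continuous_on_snd[OF continuous_on_id]]])
  have "closed (\<Inter>i\<in>{..<n}. {p :: real \<times> real \<times> (nat \<Rightarrow> real).
      perturb (fst p) (snd (snd p)) i = fst (snd p) * snd (snd p) i})"
    unfolding perturb_def
    by (intro closed_INT ballI closed_Collect_eq continuous_intros) auto
  then have "compact W"
    unfolding W_def by (intro compact_Int_closed compact_Times compact_prob_simplex compact_Icc)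
  have mem: "\<exists>q\<in>W. fst q = \<epsilon>" if \<epsilon>: "0 < \<epsilon>" "\<epsilon> \<le> 1" for \<epsilon>
  proof -
    interpret p: homogeneous_monotone n "perturb \<epsilon>"
      using that by (intro homogeneous_monotone_perturb) auto
    obtain x where x: "x \<in> prob_simplex n" "\<forall>i<n. perturb \<epsilon> x i = p.radius * x i"
      using perturb_positive_eigenvector[OF \<epsilon>(1)] by blast
    have "p.radius = (\<Sum>i<n. p.radius * x i)"
      using x by (simp add: prob_simplex_def sum_distrib_left[symmetric])
    \<comment> \<open>The coordinates of \<open>x\<close> sum to 1, so the perturbation adds exactly
      \<epsilon> to each component.\<close>
    also have "\<dots> = (\<Sum>i<n. g x i + \<epsilon>)"
      using x by (intro sum.cong) (auto simp: perturb_def prob_simplex_def)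
    also have "\<dots> \<le> (\<Sum>i<n. g (\<lambda>_. 1) i + 1)"
    proof (intro sum_mono add_mono mono)
      fix j assume "j < n"
      then have "x j \<le> (\<Sum>i<n. x i)"
        using x by (intro member_le_sum) (auto simp: prob_simplex_def)
      then show "x j \<le> 1" using x by (simp add: prob_simplex_def)
    qed (use that x in \<open>auto simp: prob_simplex_def\<close>)
    also have "\<dots> = R" by (simp add: R_def bound_def sum.distrib)
    finally have "(\<epsilon>, p.radius, x) \<in> W"
      using x ge[OF \<epsilon>(1)] \<epsilon> by (auto simp: W_def)
    then show ?thesis by force
  qed
  have "W \<noteq> {}" using mem[of "1::real"] by auto
  moreover have "continuous_on W fst" by (intro continuous_intros)
  ultimately obtain p where p: "p \<in> W" "\<And>q. q \<in> W \<Longrightarrow> fst p \<le> fst q"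
    using continuous_attains_inf[OF \<open>compact W\<close>, of fst] by blast
  \<comment> \<open>A positive minimum could be halved, since every \<epsilon> in (0, 1] occurs in
    \<open>W\<close>.\<close>
  have "fst p = 0"
  proof (rule ccontr)
    assume "fst p \<noteq> 0"
    then have "0 < fst p / 2" "fst p / 2 \<le> 1" using p(1) by (auto simp: W_def)
    from mem[OF this] p(2) \<open>0 < fst p / 2\<close> show False by fastforce
  qed
  with p(1) show ?thesis
    by (intro that[of "fst (snd p)" "snd (snd p)"]) (auto simp: W_def perturb_def)
qed

text \<open>The limit yields an eigenvalue at least \<open>radius\<close>; an eigenvector is also a
  subeigenvector, which gives the opposite inequality.\<close>

lemma radius_eigenvector:
  obtains x where "x \<in> prob_simplex n" "\<forall>i<n. g x i = radius * x i"
proof -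
  obtain r x where r: "radius \<le> r" "x \<in> prob_simplex n" "\<forall>i<n. g x i = r * x i"
    using eigenvector_limit[OF radius_le_perturb] by (metis less_imp_le)
  then have "r \<le> radius" by (intro subeigen_le_radius[of r x] subeigen_simplex) auto
  with r show ?thesis by (intro that[of x]) auto
qed

text \<open>A converse of \<open>radius_less\<close>. If all perturbed radii were at least \<eta>,
  the limit would give \<open>g\<close> an eigenvalue at least \<eta>. So some perturbed radius is
  smaller, and its positive eigenvector is the witness.\<close>

lemma radius_less_witness:
  assumes "radius < \<eta>"
  obtains x where "\<forall>i<n. 0 < x i" "\<forall>i<n. g x i < \<eta> * x i"
proof -
  have "\<exists>\<epsilon>>0. homogeneous_monotone.radius n (perturb \<epsilon>) < \<eta>"
  proof (rule ccontr)
    assume "\<not> ?thesis"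
    then have "\<eta> \<le> homogeneous_monotone.radius n (perturb \<epsilon>)" if "0 < \<epsilon>" for \<epsilon>
      using that by (meson not_less)
    then obtain r x where r: "\<eta> \<le> r" "x \<in> prob_simplex n" "\<forall>i<n. g x i = r * x i"
      by (rule eigenvector_limit)
    then have "r \<le> radius" by (intro subeigen_le_radius[of r x] subeigen_simplex) auto
    with r assms show False by simp
  qed
  then obtain \<epsilon> where e: "0 < \<epsilon>" "homogeneous_monotone.radius n (perturb \<epsilon>) < \<eta>" by blast
  obtain x where x: "x \<in> prob_simplex n" "\<forall>i<n. 0 < x i"
    "\<forall>i<n. perturb \<epsilon> x i = homogeneous_monotone.radius n (perturb \<epsilon>) * x i"
    using perturb_positive_eigenvector[OF e(1)] .
  have "g x i < \<eta> * x i" if "i < n" for i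
  proof -
    have "g x i < perturb \<epsilon> x i" using x(1) e by (simp add: perturb_def prob_simplex_def)
    also have "\<dots> \<le> \<eta> * x i"
      using x that e by (auto intro!: mult_right_mono)
    finally show ?thesis .
  qed
  with x that show ?thesis by blast
qed

end

section \<open>Homogeneous polynomial forms of tensors\<close>

lemma finite_tensor_idx [simp]: "finite (tensor_idx m n)"
  using finite_lists_length_eq[of "{..<n}" m] by (simp add: tensor_idx_def conj_commute)

text \<open>Both claims share one induction, because multiplying inequalities requires nonnegative
  factors.\<close>

lemma prod_list_map_mono:
  fixes x y :: "nat \<Rightarrow> real"
  assumes "\<And>j. j \<in> set js \<Longrightarrow> 0 \<le> x j" "\<And>j. j \<in> set js \<Longrightarrow> x j \<le> y j"
  shows "0 \<le> prod_list (map x js) \<and> prod_list (map x js) \<le> prod_list (map y js)"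
  using assms by (induction js) (auto intro!: mult_mono intro: order_trans)

lemma prod_list_map_mult_const:
  fixes x :: "nat \<Rightarrow> real"
  shows "prod_list (map (\<lambda>j. c * x j) js) = c ^ length js * prod_list (map x js)"
  by (induction js) (auto simp: algebra_simps)

lemma continuous_on_prod_list_map:
  "continuous_on UNIV (\<lambda>x :: nat \<Rightarrow> real. prod_list (map x js))"
  by (induction js) (auto intro!: continuous_intros)

text \<open>The real counterpart of \<open>tensor_apply\<close>, with vectors as functions to fit
  \<open>homogeneous_monotone\<close>.\<close>

definition tensor_form :: "nat \<Rightarrow> nat \<Rightarrow> tensor \<Rightarrow> (nat \<Rightarrow> real) \<Rightarrow> nat \<Rightarrow> real" where
  "tensor_form m n \<B> x i = (\<Sum>js\<in>tensor_idx (m - 1) n. \<B> (i # js) * prod_list (map x js))"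

lemma tensor_form_diff:
  "tensor_form m n (\<A> - \<B>) x i = tensor_form m n \<A> x i - tensor_form m n \<B> x i"
  by (simp add: tensor_form_def left_diff_distrib sum_subtractf)

lemma tensor_form_smult: "tensor_form m n (c \<cdot>\<^sub>t \<B>) x i = c * tensor_form m n \<B> x i"
  by (simp add: tensor_form_def smult_tensor_def sum_distrib_left mult.assoc)

lemma id_tensor_Cons:
  assumes "2 \<le> m" "i < n"
  shows "id_tensor m n (i # js) = (if js = replicate (m - 1) i then 1 else 0)"
proof -
  have "i # js = replicate m k \<longleftrightarrow> k = i \<and> js = replicate (m - 1) i" for k
    using assms by (cases m) auto
  then show ?thesis using assms by (auto simp: id_tensor_def)
qed

lemma replicate_in_tensor_idx: "i < n \<Longrightarrow> replicate m i \<in> tensor_idx m n"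
  by (auto simp: tensor_idx_def)

lemma tensor_form_id:
  assumes "2 \<le> m" "i < n"
  shows "tensor_form m n (id_tensor m n) x i = x i ^ (m - 1)"
proof -
  have "tensor_form m n (id_tensor m n) x i =
      (\<Sum>js\<in>tensor_idx (m - 1) n. if js = replicate (m - 1) i then x i ^ (m - 1) else 0)"
    unfolding tensor_form_def using assms
    by (intro sum.cong) (auto simp: id_tensor_Cons)
  also have "\<dots> = x i ^ (m - 1)"
    using assms by (simp add: replicate_in_tensor_idx)
  finally show ?thesis .
qed

lemma tensor_form_mat_mult:
  assumes "A \<in> carrier_mat n n" "i < n"
  shows "tensor_form m n (A *\<^sub>t \<B>) x i = (\<Sum>l<n. A $$ (i, l) * tensor_form m n \<B> x l)"
proof -
  have "tensor_form m n (A *\<^sub>t \<B>) x i =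
      (\<Sum>js\<in>tensor_idx (m - 1) n. \<Sum>l<n. A $$ (i, l) * (\<B> (l # js) * prod_list (map x js)))"
    using assms by (simp add: tensor_form_def mat_mult_tensor_def sum_distrib_right mult.assoc)
  also have "\<dots> = (\<Sum>l<n. A $$ (i, l) * tensor_form m n \<B> x l)"
    by (subst sum.swap) (simp add: tensor_form_def sum_distrib_left)
  finally show ?thesis .
qed

lemma tensor_form_mono:
  assumes "nonneg_tensor \<B>" "\<And>j. j < n \<Longrightarrow> 0 \<le> x j" "\<And>j. j < n \<Longrightarrow> x j \<le> y j"
  shows "tensor_form m n \<B> x i \<le> tensor_form m n \<B> y i"
  unfolding tensor_form_def
proof (intro sum_mono mult_left_mono)
  fix js assume "js \<in> tensor_idx (m - 1) n"
  then have "\<And>j. j \<in> set js \<Longrightarrow> j < n" by (auto simp: tensor_idx_def)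
  then show "prod_list (map x js) \<le> prod_list (map y js)"
    using assms prod_list_map_mono[of js x y] by auto
qed (use assms in \<open>auto simp: nonneg_tensor_def\<close>)

lemma tensor_form_nonneg:
  assumes "nonneg_tensor \<B>" "\<And>j. j < n \<Longrightarrow> 0 \<le> x j"
  shows "0 \<le> tensor_form m n \<B> x i"
  unfolding tensor_form_def
proof (intro sum_nonneg mult_nonneg_nonneg)
  fix js assume "js \<in> tensor_idx (m - 1) n"
  then have "\<And>j. j \<in> set js \<Longrightarrow> j < n" by (auto simp: tensor_idx_def)
  then show "0 \<le> prod_list (map x js)"
    using assms prod_list_map_mono[of js x x] by auto
qed (use assms in \<open>auto simp: nonneg_tensor_def\<close>)

lemma tensor_form_scale:
  "tensor_form m n \<B> (\<lambda>j. c * x j) i = c ^ (m - 1) * tensor_form m n \<B> x i"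
  unfolding tensor_form_def sum_distrib_left
  by (intro sum.cong) (auto simp: prod_list_map_mult_const tensor_idx_def)

lemma continuous_on_tensor_form: "continuous_on UNIV (\<lambda>x. tensor_form m n \<B> x i)"
  unfolding tensor_form_def by (intro continuous_intros continuous_on_prod_list_map)

subsection \<open>Perron--Frobenius theory of nonnegative tensors\<close>

text \<open>Taking roots turns a nonnegative tensor into a map that is homogeneous of degree 1.\<close>

definition root_form :: "nat \<Rightarrow> nat \<Rightarrow> tensor \<Rightarrow> (nat \<Rightarrow> real) \<Rightarrow> nat \<Rightarrow> real" where
  "root_form m n \<B> x i = root (m - 1) (tensor_form m n \<B> x i)"

locale nonnegative_tensor =
  fixes m n :: nat and \<B> :: tensor
  assumes m: "2 \<le> m" and n: "0 < n" and nonneg_entries: "nonneg_tensor \<B>"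

sublocale nonnegative_tensor \<subseteq> homogeneous_monotone n "root_form m n \<B>"
proof
  fix x y :: "nat \<Rightarrow> real" and i
  assume "\<And>j. j < n \<Longrightarrow> 0 \<le> x j" "\<And>j. j < n \<Longrightarrow> x j \<le> y j" "i < n"
  then show "root_form m n \<B> x i \<le> root_form m n \<B> y i"
    using m nonneg_entries by (simp add: root_form_def tensor_form_mono)
next
  fix c :: real and x :: "nat \<Rightarrow> real" and i
  assume "0 \<le> c"
  then show "root_form m n \<B> (\<lambda>j. c * x j) i = c * root_form m n \<B> x i"
    using m by (simp add: root_form_def tensor_form_scale real_root_mult real_root_power_cancel)
next
  fix i
  show "continuous_on UNIV (\<lambda>x. root_form m n \<B> x i)"
    unfolding root_form_def by (intro continuous_intros continuous_on_tensor_form)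
qed (rule n)

context nonnegative_tensor
begin

lemma root_form_power:
  assumes "\<And>j. j < n \<Longrightarrow> 0 \<le> x j"
  shows "root_form m n \<B> x i ^ (m - 1) = tensor_form m n \<B> x i"
  using m assms nonneg_entries by (simp add: root_form_def tensor_form_nonneg)

text \<open>Raising the eigenvector equation of \<open>root_form\<close> to the power
  \<open>m - 1\<close> gives the tensor equation, read over the complex numbers.\<close>

lemma eigenvalue_radius: "tensor_eigenvalue m n \<B> (complex_of_real (radius ^ (m - 1)))"
proof -
  obtain x where x: "x \<in> prob_simplex n" "\<forall>i<n. root_form m n \<B> x i = radius * x i"
    by (rule radius_eigenvector)
  have nn: "0 \<le> x i" for i using x by (auto simp: prob_simplex_def)
  define z where "z = vec n (\<lambda>i. complex_of_real (x i))"
  obtain k where k: "k < n" "0 < x k" using prob_simplex_pos_coordinate[OF x(1)] by blast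
  have "z $ k \<noteq> 0" using k by (simp add: z_def)
  then have "z \<noteq> 0\<^sub>v n" using k by auto
  moreover have "tensor_apply m n \<B> z $ i =
      complex_of_real (radius ^ (m - 1)) * z $ i ^ (m - 1)" if "i < n" for i
  proof -
    \<comment> \<open>The restriction on \<open>js\<close> matters: entries of \<open>z\<close> are
      specified below \<open>n\<close> only.\<close>
    have prod: "prod_list (map (($) z) js) = complex_of_real (prod_list (map x js))"
      if "set js \<subseteq> {..<n}" for js
      using that by (induction js) (auto simp: z_def)
    have "tensor_apply m n \<B> z $ i = (\<Sum>js\<in>tensor_idx (m - 1) n.
        complex_of_real (\<B> (i # js)) * complex_of_real (prod_list (map x js)))"
      using that by (auto simp: tensor_apply_def prod tensor_idx_def intro!: sum.cong)
    also have "\<dots> = complex_of_real (tensor_form m n \<B> x i)"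
      by (simp add: tensor_form_def)
    also have "tensor_form m n \<B> x i = (radius * x i) ^ (m - 1)"
      using root_form_power[of x i] nn x that by simp
    finally show ?thesis using that by (simp add: z_def power_mult_distrib)
  qed
  then have "tensor_apply m n \<B> z =
      complex_of_real (radius ^ (m - 1)) \<cdot>\<^sub>v map_vec (\<lambda>z. z ^ (m - 1)) z"
    by (intro eq_vecI) (auto simp: z_def tensor_apply_def)
  ultimately show ?thesis
    unfolding tensor_eigenvalue_def by (intro bexI[of _ z]) (auto simp: z_def)
qed

text \<open>By the triangle inequality, the moduli of a complex eigenvector form a subeigenvector
  for the root of the modulus of \<mu>.\<close>

lemma eigenvalue_le_radius:
  assumes "tensor_eigenvalue m n \<B> \<mu>"
  shows "cmod \<mu> \<le> radius ^ (m - 1)"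
proof -
  obtain z where z: "z \<in> carrier_vec n" "z \<noteq> 0\<^sub>v n"
    "tensor_apply m n \<B> z = \<mu> \<cdot>\<^sub>v map_vec (\<lambda>z. z ^ (m - 1)) z"
    using assms by (auto simp: tensor_eigenvalue_def)
  define y where "y = (\<lambda>i. cmod (z $ i))"
  have "\<exists>k<n. z $ k \<noteq> 0"
    using z(1,2) by (metis eq_vecI carrier_vecD index_zero_vec)
  then have ex: "\<exists>k<n. 0 < y k" by (auto simp: y_def)
  have "root (m - 1) (cmod \<mu>) * y i \<le> root_form m n \<B> y i" if "i < n" for i
  proof -
    have prod: "cmod (prod_list (map (($) z) js)) = prod_list (map y js)" for js
      by (induction js) (auto simp: y_def norm_mult)
    have "\<mu> * z $ i ^ (m - 1) = tensor_apply m n \<B> z $ i"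
      using z that by simp
    then have "cmod \<mu> * y i ^ (m - 1) = cmod (tensor_apply m n \<B> z $ i)"
      by (simp add: y_def norm_mult[symmetric] norm_power[symmetric])
    also have "\<dots> \<le> (\<Sum>js\<in>tensor_idx (m - 1) n.
        cmod (complex_of_real (\<B> (i # js)) * prod_list (map (($) z) js)))"
      using that by (simp add: tensor_apply_def norm_sum)
    also have "\<dots> = tensor_form m n \<B> y i"
      using nonneg_entries by (simp add: tensor_form_def norm_mult prod nonneg_tensor_def)
    finally have "root (m - 1) (cmod \<mu> * y i ^ (m - 1)) \<le> root_form m n \<B> y i"
      using m by (simp add: root_form_def)
    then show ?thesis
      using m by (simp add: real_root_mult real_root_power_cancel y_def)
  qed
  then have "subeigen (root (m - 1) (cmod \<mu>)) y"
    using ex by (auto simp: subeigen_def y_def)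
  then have "root (m - 1) (cmod \<mu>) \<le> radius" by (rule subeigen_le_radius)
  then have "root (m - 1) (cmod \<mu>) ^ (m - 1) \<le> radius ^ (m - 1)"
    using m by (intro power_mono) auto
  then show ?thesis using m by simp
qed

lemma spectral_radius_eq: "tensor_spectral_radius m n \<B> = radius ^ (m - 1)"
  unfolding tensor_spectral_radius_def
proof (rule Greatest_equality)
  have "cmod (complex_of_real (radius ^ (m - 1))) = radius ^ (m - 1)"
    using radius_nonneg by (simp add: norm_power)
  then show "\<exists>\<mu>. tensor_eigenvalue m n \<B> \<mu> \<and> radius ^ (m - 1) = cmod \<mu>"
    using eigenvalue_radius by metis
qed (use eigenvalue_le_radius in auto)

lemma spectral_radius_less_witness:
  assumes "tensor_spectral_radius m n \<B> < \<eta>"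
  obtains x where "\<forall>i<n. 0 < x i" "\<forall>i<n. tensor_form m n \<B> x i < \<eta> * x i ^ (m - 1)"
proof -
  have lt: "radius ^ (m - 1) < \<eta>" using assms by (simp add: spectral_radius_eq)
  \<comment> \<open>Positivity allows the root of \<eta> to be undone at the end.\<close>
  then have eta: "0 < \<eta>" using radius_nonneg zero_le_power le_less_trans by blast
  have "root (m - 1) (radius ^ (m - 1)) < root (m - 1) \<eta>" using lt m by simp
  then have "radius < root (m - 1) \<eta>"
    using m radius_nonneg by (simp add: real_root_power_cancel)
  then obtain x where x: "\<forall>i<n. 0 < x i" "\<forall>i<n. root_form m n \<B> x i < root (m - 1) \<eta> * x i"
    by (rule radius_less_witness)
  have "tensor_form m n \<B> x i < \<eta> * x i ^ (m - 1)" if "i < n" for i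
  proof -
    have "0 \<le> root_form m n \<B> x i" using x that by (intro nonneg) (auto intro: less_imp_le)
    then have "root_form m n \<B> x i ^ (m - 1) < (root (m - 1) \<eta> * x i) ^ (m - 1)"
      using x that m by (intro power_strict_mono) auto
    then show ?thesis
      using root_form_power[of x i] x m eta by (simp add: power_mult_distrib less_imp_le)
  qed
  with x that show ?thesis by blast
qed

lemma spectral_radius_less:
  assumes x: "\<And>i. i < n \<Longrightarrow> 0 < x i" "\<And>i. i < n \<Longrightarrow> tensor_form m n \<B> x i < \<eta> * x i ^ (m - 1)"
    and eta: "0 < \<eta>"
  shows "tensor_spectral_radius m n \<B> < \<eta>"
proof -
  have "root_form m n \<B> x i < root (m - 1) \<eta> * x i" if "i < n" for i
  proof -
    have "root_form m n \<B> x i < root (m - 1) (\<eta> * x i ^ (m - 1))"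
      using x(2)[OF that] m by (simp add: root_form_def)
    also have "\<dots> = root (m - 1) \<eta> * x i"
      using m x(1)[OF that] by (simp add: real_root_mult real_root_power_cancel)
    finally show ?thesis .
  qed
  then have "radius < root (m - 1) \<eta>" using x(1) by (intro radius_less)
  then have "radius ^ (m - 1) < root (m - 1) \<eta> ^ (m - 1)"
    using m radius_nonneg by (intro power_strict_mono) auto
  then show ?thesis using m eta by (simp add: spectral_radius_eq)
qed

end

subsection \<open>Products of matrices and tensors\<close>

lemma mat_mult_tensor_Nil [simp]: "(A *\<^sub>t \<B>) [] = 0"
  by (simp add: mat_mult_tensor_def)

lemma mat_mult_tensor_Cons:
  assumes "A \<in> carrier_mat n n"
  shows "(A *\<^sub>t \<B>) (j # js) = (if j < n then \<Sum>l<n. A $$ (j, l) * \<B> (l # js) else 0)"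
  using assms by (simp add: mat_mult_tensor_def)

lemma tensor_eqI:
  fixes \<A> \<B> :: tensor
  assumes "\<A> [] = \<B> []" "\<And>j js. \<A> (j # js) = \<B> (j # js)"
  shows "\<A> = \<B>"
proof
  show "\<A> is = \<B> is" for "is" using assms by (cases "is") auto
qed

lemma mat_mult_tensor_one:
  assumes "\<A> \<in> carrier_tensor m n" "0 < m"
  shows "1\<^sub>m n *\<^sub>t \<A> = \<A>"
proof (rule tensor_eqI)
  \<comment> \<open>Since \<open>m\<close> is positive, the empty list is no index and both sides
    take the default value 0.\<close>
  show "(1\<^sub>m n *\<^sub>t \<A>) [] = \<A> []"
    using assms by (auto simp: carrier_tensor_def tensor_idx_def)
  fix j js
  have "j \<ge> n \<Longrightarrow> \<A> (j # js) = 0"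
    using assms by (auto simp: carrier_tensor_def tensor_idx_def)
  moreover have "(\<Sum>l<n. 1\<^sub>m n $$ (j, l) * \<A> (l # js)) = \<A> (j # js)" if "j < n"
  proof -
    have "(\<Sum>l<n. 1\<^sub>m n $$ (j, l) * \<A> (l # js)) = (\<Sum>l<n. if j = l then \<A> (l # js) else 0)"
      using that by (intro sum.cong) auto
    then show ?thesis using that by simp
  qed
  ultimately show "(1\<^sub>m n *\<^sub>t \<A>) (j # js) = \<A> (j # js)"
    by (subst mat_mult_tensor_Cons[of _ n]) auto
qed

lemma mat_mult_tensor_add_mat:
  assumes "A \<in> carrier_mat n n" "B \<in> carrier_mat n n"
  shows "(A + B) *\<^sub>t \<T> = A *\<^sub>t \<T> + B *\<^sub>t \<T>"
  using assms
  by (intro tensor_eqI)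
    (auto simp: mat_mult_tensor_Cons[of _ n] plus_fun_def distrib_right sum.distrib)

lemma mat_mult_tensor_diff_mat:
  assumes "A \<in> carrier_mat n n" "B \<in> carrier_mat n n"
  shows "(A - B) *\<^sub>t \<T> = A *\<^sub>t \<T> - B *\<^sub>t \<T>"
  using assms
  by (intro tensor_eqI)
    (auto simp: mat_mult_tensor_Cons[of _ n] fun_diff_def left_diff_distrib sum_subtractf
      minus_carrier_mat)

lemma mat_mult_tensor_diff:
  assumes "A \<in> carrier_mat n n"
  shows "A *\<^sub>t (\<T> - \<U>) = A *\<^sub>t \<T> - A *\<^sub>t \<U>"
  using assms
  by (intro tensor_eqI)
    (auto simp: mat_mult_tensor_Cons[of _ n] fun_diff_def right_diff_distrib sum_subtractf)

lemma mat_mult_tensor_assoc: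
  assumes "A \<in> carrier_mat n n" "B \<in> carrier_mat n n"
  shows "(A * B) *\<^sub>t \<T> = A *\<^sub>t (B *\<^sub>t \<T>)"
proof (rule tensor_eqI)
  fix j js
  show "((A * B) *\<^sub>t \<T>) (j # js) = (A *\<^sub>t (B *\<^sub>t \<T>)) (j # js)"
  proof (cases "j < n")
    case True
    have "(\<Sum>l<n. (A * B) $$ (j, l) * \<T> (l # js)) =
        (\<Sum>l<n. \<Sum>k<n. A $$ (j, k) * (B $$ (k, l) * \<T> (l # js)))"
      using assms True
      by (intro sum.cong) (auto simp: scalar_prod_def sum_distrib_right mult.assoc lessThan_atLeast0)
    also have "\<dots> = (\<Sum>k<n. A $$ (j, k) * (\<Sum>l<n. B $$ (k, l) * \<T> (l # js)))"
      by (subst sum.swap) (simp add: sum_distrib_left)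
    finally show ?thesis
      using assms True by (simp add: mat_mult_tensor_Cons[of _ n])
  next
    case False
    then show ?thesis using assms by (simp add: mat_mult_tensor_Cons[of _ n])
  qed
qed simp

lemma nonneg_mat_mult_tensor:
  assumes "A \<in> carrier_mat n n" "\<And>i j. i < n \<Longrightarrow> j < n \<Longrightarrow> 0 \<le> A $$ (i, j)" "nonneg_tensor \<B>"
  shows "nonneg_tensor (A *\<^sub>t \<B>)"
  unfolding nonneg_tensor_def
proof
  fix "is"
  show "0 \<le> (A *\<^sub>t \<B>) is"
    using assms
    by (cases "is") (auto simp: mat_mult_tensor_Cons[of _ n] nonneg_tensor_def intro!: sum_nonneg)
qed

lemma nonneg_tensor_add: "nonneg_tensor \<A> \<Longrightarrow> nonneg_tensor \<B> \<Longrightarrow> nonneg_tensor (\<A> + \<B>)"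
  by (simp add: nonneg_tensor_def)

lemma mat_mult_tensor_carrier:
  assumes "A \<in> carrier_mat n n" "0 < m" "\<B> \<in> carrier_tensor m n"
  shows "A *\<^sub>t \<B> \<in> carrier_tensor m n"
  unfolding carrier_tensor_def
proof (intro CollectI allI impI)
  fix "is" assume "is \<notin> tensor_idx m n"
  show "(A *\<^sub>t \<B>) is = 0"
  proof (cases "is")
    case (Cons j js)
    have "\<B> (l # js) = 0" if "j < n" "l < n" for l
    proof -
      have "l # js \<notin> tensor_idx m n"
        using \<open>is \<notin> tensor_idx m n\<close> that Cons by (auto simp: tensor_idx_def)
      with assms show ?thesis by (simp add: carrier_tensor_def)
    qed
    then show ?thesis using assms Cons by (simp add: mat_mult_tensor_Cons[of _ n])
  qed simp
qed

lemma id_tensor_carrier: "id_tensor m n \<in> carrier_tensor m n"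
  by (auto simp: id_tensor_def carrier_tensor_def tensor_idx_def)

lemma diff_carrier_tensor:
  "\<A> \<in> carrier_tensor m n \<Longrightarrow> \<B> \<in> carrier_tensor m n \<Longrightarrow> \<A> - \<B> \<in> carrier_tensor m n"
  by (auto simp: carrier_tensor_def)

lemma replicate_eq_replicate_iff_pos: "0 < k \<Longrightarrow> replicate k i = replicate k j \<longleftrightarrow> i = j"
  by (cases k) auto

lemma mat_mult_id_tensor_replicate:
  assumes "M \<in> carrier_mat n n" "2 \<le> m" "i < n" "j < n"
  shows "(M *\<^sub>t id_tensor m n) (i # replicate (m - 1) j) = M $$ (i, j)"
proof -
  have "(M *\<^sub>t id_tensor m n) (i # replicate (m - 1) j) =
      (\<Sum>l<n. M $$ (i, l) * id_tensor m n (l # replicate (m - 1) j))"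
    using assms by (simp add: mat_mult_tensor_Cons[of _ n])
  also have "\<dots> = (\<Sum>l<n. if l = j then M $$ (i, l) else 0)"
    using assms
    by (intro sum.cong) (auto simp: id_tensor_Cons replicate_eq_replicate_iff_pos)
  finally show ?thesis using assms by simp
qed

lemma mat_mult_id_tensor_eq_0:
  assumes "M \<in> carrier_mat n n" "2 \<le> m" "\<And>j. j < n \<Longrightarrow> js \<noteq> replicate (m - 1) j"
  shows "(M *\<^sub>t id_tensor m n) (i # js) = 0"
  using assms by (auto simp: mat_mult_tensor_Cons[of _ n] id_tensor_Cons intro!: sum.neutral)

lemma majorization_mat_mult_id_tensor:
  assumes "M \<in> carrier_mat n n" "2 \<le> m"
  shows "majorization_mat m n (M *\<^sub>t id_tensor m n) = M"
  using assms unfolding majorization_mat_def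
  by (intro eq_matI) (auto simp: mat_mult_id_tensor_replicate[of _ n, unfolded One_nat_def])

section \<open>Inverse matrices and a convergence criterion\<close>

text \<open>Evaluates the inverse inside \<open>convergent_splitting\<close>: \<open>None\<close> is
  impossible for a unit, and two-sided inverses are unique.\<close>

lemma mat_inverse_eqI:
  fixes M N :: "'a :: field mat"
  assumes "M \<in> carrier_mat n n" "N \<in> carrier_mat n n" "M * N = 1\<^sub>m n" "N * M = 1\<^sub>m n"
  shows "mat_inverse M = Some N"
proof (cases "mat_inverse M")
  case None
  have "M \<in> Units (ring_mat TYPE('a) n ())"
    using assms by (auto simp: Units_def ring_mat_def)
  with mat_inverse(1)[OF assms(1) None, of "()"] show ?thesis by blast
next
  case (Some N')
  from mat_inverse(2)[OF assms(1) Some] have N': "M * N' = 1\<^sub>m n" "N' \<in> carrier_mat n n"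
    by auto
  have "N = N * (M * N')" using assms N' by simp
  also have "\<dots> = (N * M) * N'" using assms N' by (intro assoc_mult_mat[symmetric]) auto
  also have "\<dots> = N'" using assms N' by simp
  finally show ?thesis using Some by simp
qed

text \<open>With \<open>N\<close> the inverse of \<open>M\<close>, the iteration tensor is the
  identity tensor minus \<open>N\<close> times \<C>. At \<open>x\<close> its form is therefore below
  the power \<open>m - 1\<close> of \<open>x\<close>, and \<open>spectral_radius_less\<close>
  applies with bound 1.\<close>

lemma convergent_splittingI:
  assumes m: "2 \<le> m" and n: "0 < n"
    and M: "M \<in> carrier_mat n n" and N: "N \<in> carrier_mat n n"
    and MN: "M * N = 1\<^sub>m n" and NM: "N * M = 1\<^sub>m n"
    and \<E>: "\<E> = M *\<^sub>t id_tensor m n" and \<C>: "\<C> \<in> carrier_tensor m n" and \<G>: "\<G> = \<E> - \<C>"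
    and nonneg: "nonneg_tensor (N *\<^sub>t \<G>)"
    and x: "\<And>i. i < n \<Longrightarrow> 0 < x i" "\<And>i. i < n \<Longrightarrow> 0 < tensor_form m n (N *\<^sub>t \<C>) x i"
  shows "convergent_splitting m n \<C> \<E> \<G>"
proof -
  interpret G: nonnegative_tensor m n "N *\<^sub>t \<G>"
    using m n nonneg by unfold_locales
  have maj: "majorization_mat m n \<E> = M"
    using \<E> M m by (simp add: majorization_mat_mult_id_tensor)
  have \<E>_carrier: "\<E> \<in> carrier_tensor m n"
    unfolding \<E> using M m by (intro mat_mult_tensor_carrier id_tensor_carrier) auto
  have "N *\<^sub>t \<E> = id_tensor m n"
    unfolding \<E> using M N NM m
    by (simp add: mat_mult_tensor_assoc[symmetric, of _ n] mat_mult_tensor_one[OF id_tensor_carrier])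
  then have form: "tensor_form m n (N *\<^sub>t \<G>) x i = x i ^ (m - 1) - tensor_form m n (N *\<^sub>t \<C>) x i"
    if "i < n" for i
    using that m N by (simp add: \<G> mat_mult_tensor_diff[of _ n] tensor_form_diff tensor_form_id)
  have "tensor_spectral_radius m n (N *\<^sub>t \<G>) < 1"
    using x form by (intro G.spectral_radius_less[of x]) auto
  moreover have "invertible_mat M"
    using M N MN NM unfolding invertible_mat_def inverts_mat_def by (intro conjI exI[of _ N]) auto
  then have "is_splitting m n \<C> \<E> \<G>"
    unfolding is_splitting_def left_nonsingular_def maj
    using \<E>_carrier \<C> by (auto simp: \<G> \<E> intro!: diff_carrier_tensor)
  ultimately show ?thesis
    by (simp add: convergent_splitting_def maj mat_inverse_eqI[OF M N MN NM])
qed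

text \<open>Weighted strict diagonal dominance: a kernel vector contradicts \<open>dom\<close> in
  the row where its modulus relative to \<open>y\<close> is largest.\<close>

lemma invertible_one_plus:
  fixes Q :: "real mat"
  assumes Q: "Q \<in> carrier_mat n n" and y: "\<And>i. i < n \<Longrightarrow> 0 < y i"
    and dom: "\<And>i. i < n \<Longrightarrow> (\<Sum>j<n. \<bar>Q $$ (i, j)\<bar> * y j) < y i"
  obtains N where "N \<in> carrier_mat n n" "(1\<^sub>m n + Q) * N = 1\<^sub>m n" "N * (1\<^sub>m n + Q) = 1\<^sub>m n"
proof -
  have P: "1\<^sub>m n + Q \<in> carrier_mat n n" using Q by simp
  have "det (1\<^sub>m n + Q) \<noteq> 0"
  proof
    assume "det (1\<^sub>m n + Q) = 0"
    then obtain v where v: "v \<in> carrier_vec n" "v \<noteq> 0\<^sub>v n" "(1\<^sub>m n + Q) *\<^sub>v v = 0\<^sub>v n"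
      using det_0_iff_vec_prod_zero_field[OF P] by blast
    obtain l where l: "l < n" "v $ l \<noteq> 0"
      using v(1,2) by (metis eq_vecI carrier_vecD index_zero_vec)
    \<comment> \<open>The sup norm of \<open>v\<close> with weights \<open>y\<close>, attained at
      \<open>k\<close>.\<close>
    define t where "t = Max ((\<lambda>i. \<bar>v $ i\<bar> / y i) ` {..<n})"
    have "t \<in> (\<lambda>i. \<bar>v $ i\<bar> / y i) ` {..<n}"
      unfolding t_def using l by (intro Max_in) auto
    then obtain k where k: "k < n" "t = \<bar>v $ k\<bar> / y k" by auto
    have le: "\<bar>v $ i\<bar> \<le> t * y i" if "i < n" for i
    proof -
      have "\<bar>v $ i\<bar> / y i \<le> t" unfolding t_def using that by (intro Max_ge) auto
      then show ?thesis using y[OF that] by (simp add: field_simps)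
    qed
    have "0 < t * y l" using le[OF l(1)] l by simp
    then have t: "0 < t" using y[OF l(1)] by (simp add: zero_less_mult_iff)
    have "0 = ((1\<^sub>m n + Q) *\<^sub>v v) $ k" using v k by simp
    also have "\<dots> = (v + Q *\<^sub>v v) $ k"
      using Q v by (simp add: add_mult_distrib_mat_vec[of _ n n])
    also have "\<dots> = v $ k + (\<Sum>j<n. Q $$ (k, j) * v $ j)"
      using Q v k by (simp add: scalar_prod_def lessThan_atLeast0)
    finally have "\<bar>v $ k\<bar> = \<bar>\<Sum>j<n. Q $$ (k, j) * v $ j\<bar>" by linarith
    also have "\<dots> \<le> (\<Sum>j<n. \<bar>Q $$ (k, j)\<bar> * \<bar>v $ j\<bar>)"
      using sum_abs[of "\<lambda>j. Q $$ (k, j) * v $ j" "{..<n}"] by (simp add: abs_mult)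
    also have "\<dots> \<le> (\<Sum>j<n. \<bar>Q $$ (k, j)\<bar> * (t * y j))"
      using le by (intro sum_mono mult_left_mono) auto
    also have "\<dots> = t * (\<Sum>j<n. \<bar>Q $$ (k, j)\<bar> * y j)"
      by (simp add: sum_distrib_left algebra_simps)
    also have "\<dots> < t * y k" using dom[OF k(1)] t by simp
    also have "\<dots> = \<bar>v $ k\<bar>" using k y[OF k(1)] by (simp add: field_simps)
    finally show False by simp
  qed
  from det_non_zero_imp_unit[OF P this, of undefined] that show ?thesis
    by (auto simp: Units_def ring_mat_def)
qed

subsection \<open>Strong M-tensors with unit diagonal\<close>

locale unit_strong_M_tensor =
  fixes m n :: nat and \<A> :: tensor
  assumes m: "2 \<le> m" and n: "2 \<le> n"
    and carrier: "\<A> \<in> carrier_tensor m n"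
    and strong_M: "strong_M_tensor m n \<A>"
    and diag: "i < n \<Longrightarrow> \<A> (replicate m i) = 1"
begin

definition off :: tensor where
  "off = id_tensor m n - \<A>"

lemma lower_plus_rest: "lower_tensor m n \<A> + rest_tensor m n \<A> = off"
  by (simp add: rest_tensor_def off_def)

text \<open>The entries vanish on the diagonal by normalisation and agree with those of \<B>
  elsewhere.\<close>

lemma nonneg_off: "nonneg_tensor off"
  unfolding nonneg_tensor_def
proof
  fix "is"
  obtain \<eta> \<B> where "nonneg_tensor \<B>" "\<A> = \<eta> \<cdot>\<^sub>t id_tensor m n - \<B>"
    using strong_M by (auto simp: strong_M_tensor_def)
  moreover have "off is = 0" if "is = replicate m i" "i < n" for i
    using that diag by (auto simp: off_def id_tensor_def)
  moreover have "off is = - \<A> is" if "\<forall>i<n. is \<noteq> replicate m i"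
    using that by (simp add: off_def id_tensor_def)
  ultimately show "0 \<le> off is"
    by (cases "\<exists>i<n. is = replicate m i")
      (auto simp: id_tensor_def nonneg_tensor_def smult_tensor_def)
qed

lemma positive_vector:
  obtains x where "\<And>i. i < n \<Longrightarrow> 0 < x i" "\<And>i. i < n \<Longrightarrow> 0 < tensor_form m n \<A> x i"
proof -
  obtain \<eta> \<B> where B: "nonneg_tensor \<B>" "tensor_spectral_radius m n \<B> < \<eta>"
    "\<A> = \<eta> \<cdot>\<^sub>t id_tensor m n - \<B>"
    using strong_M by (auto simp: strong_M_tensor_def)
  interpret B: nonnegative_tensor m n \<B>
    using m n B(1) by unfold_locales auto
  obtain x where x: "\<forall>i<n. 0 < x i" "\<forall>i<n. tensor_form m n \<B> x i < \<eta> * x i ^ (m - 1)"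
    by (rule B.spectral_radius_less_witness[OF B(2)])
  have "0 < tensor_form m n \<A> x i" if "i < n" for i
    using that x m by (simp add: B(3) tensor_form_diff tensor_form_smult tensor_form_id)
  with x that show ?thesis by blast
qed

lemma off_entry_nonneg: "0 \<le> off is"
  using nonneg_off by (simp add: nonneg_tensor_def)

text \<open>The left side collects the terms with constant index lists; the remaining terms are
  nonnegative. This later bounds the weighted row sums of a preconditioner.\<close>

lemma off_majorization_le:
  assumes x: "\<And>i. i < n \<Longrightarrow> 0 < x i" and i: "i < n"
  shows "(\<Sum>j<n. off (i # replicate (m - 1) j) * x j ^ (m - 1)) \<le> tensor_form m n off x i"
proof -
  let ?f = "\<lambda>js. off (i # js) * prod_list (map x js)"
  have "(\<Sum>j<n. off (i # replicate (m - 1) j) * x j ^ (m - 1)) = sum ?f (replicate (m - 1) ` {..<n})"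
    using m by (subst sum.reindex) (auto simp: inj_on_def replicate_eq_replicate_iff_pos)
  also have "\<dots> \<le> sum ?f (tensor_idx (m - 1) n)"
  proof (rule sum_mono2)
    show "replicate (m - 1) ` {..<n} \<subseteq> tensor_idx (m - 1) n"
      using replicate_in_tensor_idx by auto
    fix js assume "js \<in> tensor_idx (m - 1) n - replicate (m - 1) ` {..<n}"
    then have "j \<in> set js \<Longrightarrow> 0 \<le> x j" for j
      using x by (auto simp: tensor_idx_def intro: less_imp_le)
    then show "0 \<le> ?f js"
      using nonneg_off prod_list_map_mono[of js x x] by (auto simp: nonneg_tensor_def)
  qed simp
  finally show ?thesis by (simp add: tensor_form_def)
qed

section \<open>Preconditioners controlled by the off-diagonal entries\<close>

text \<open>Captures what the proof uses of \<open>S_mat\<close>, \<open>K_mat\<close> and their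
  sum. As \<open>off\<close> vanishes on the diagonal, so does \<open>Q\<close>, and 1 + Q has unit
  diagonal.\<close>

definition dominated :: "real mat \<Rightarrow> bool" where
  "dominated Q \<longleftrightarrow> Q \<in> carrier_mat n n \<and>
     (\<forall>i<n. \<forall>j<n. 0 \<le> Q $$ (i, j) \<and> Q $$ (i, j) \<le> off (i # replicate (m - 1) j))"

lemma dominated_carrier: "dominated Q \<Longrightarrow> Q \<in> carrier_mat n n"
  by (simp add: dominated_def)

text \<open>The subtracted tensor is supported where the trailing indices all coincide, and there
  domination is exactly the required inequality.\<close>

lemma nonneg_off_minus:
  assumes "dominated Q"
  shows "nonneg_tensor (off - Q *\<^sub>t id_tensor m n)"
  unfolding nonneg_tensor_def
proof
  fix "is"
  have Q: "Q \<in> carrier_mat n n" using assms by (rule dominated_carrier)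
  have off: "0 \<le> off is" by (rule off_entry_nonneg)
  show "0 \<le> (off - Q *\<^sub>t id_tensor m n) is"
  proof (cases "is")
    case Nil
    then show ?thesis using off by simp
  next
    case (Cons i js)
    show ?thesis
    proof (cases "i < n \<and> (\<exists>j<n. js = replicate (m - 1) j)")
      case True
      then show ?thesis
        using assms Cons Q m by (auto simp: dominated_def mat_mult_id_tensor_replicate[unfolded One_nat_def])
    next
      case False
      then have "(Q *\<^sub>t id_tensor m n) (i # js) = 0"
        using Q m mat_mult_id_tensor_eq_0[of Q n m js i] by (cases "i < n") (auto simp: mat_mult_tensor_Cons[of _ n])
      then show ?thesis using off Cons by simp
    qed
  qed
qed

text \<open>Expansion of \<A> as identity minus \<open>off\<close>. The grouping in the first
  equation displays the subtracted tensor as a sum of two nonnegative tensors.\<close>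

lemma preconditioned_eq:
  assumes "dominated Q"
  shows "(1\<^sub>m n + Q) *\<^sub>t \<A> = id_tensor m n - (off - Q *\<^sub>t id_tensor m n + Q *\<^sub>t off)"
    and "(1\<^sub>m n + Q) *\<^sub>t off = off + Q *\<^sub>t off"
    and "(1\<^sub>m n + Q) *\<^sub>t id_tensor m n = id_tensor m n + Q *\<^sub>t id_tensor m n"
proof -
  have Q: "Q \<in> carrier_mat n n" using assms by (rule dominated_carrier)
  have "off \<in> carrier_tensor m n"
    unfolding off_def using carrier id_tensor_carrier by (rule diff_carrier_tensor[rotated])
  then show off: "(1\<^sub>m n + Q) *\<^sub>t off = off + Q *\<^sub>t off"
    using Q m by (simp add: mat_mult_tensor_add_mat[of _ n] mat_mult_tensor_one)
  show id: "(1\<^sub>m n + Q) *\<^sub>t id_tensor m n = id_tensor m n + Q *\<^sub>t id_tensor m n"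
    using Q m by (simp add: mat_mult_tensor_add_mat[of _ n] mat_mult_tensor_one[OF id_tensor_carrier])
  have "id_tensor m n - off = \<A>" by (simp add: off_def)
  then have "(1\<^sub>m n + Q) *\<^sub>t \<A> = (1\<^sub>m n + Q) *\<^sub>t id_tensor m n - (1\<^sub>m n + Q) *\<^sub>t off"
    using Q mat_mult_tensor_diff[of "1\<^sub>m n + Q" n "id_tensor m n" off] by simp
  then show "(1\<^sub>m n + Q) *\<^sub>t \<A> = id_tensor m n - (off - Q *\<^sub>t id_tensor m n + Q *\<^sub>t off)"
    by (simp add: off id)
qed

lemma preconditioned_carrier: "dominated Q \<Longrightarrow> (1\<^sub>m n + Q) *\<^sub>t \<A> \<in> carrier_tensor m n"
  using m carrier dominated_carrier by (intro mat_mult_tensor_carrier) auto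

lemma preconditioned_positive:
  assumes "dominated Q"
    and x: "\<And>i. i < n \<Longrightarrow> 0 < x i" "\<And>i. i < n \<Longrightarrow> 0 < tensor_form m n \<A> x i" and "i < n"
  shows "0 < tensor_form m n ((1\<^sub>m n + Q) *\<^sub>t \<A>) x i"
proof -
  have Q: "Q \<in> carrier_mat n n" using assms by (simp add: dominated_def)
  have "(1\<^sub>m n + Q) *\<^sub>t \<A> = \<A> + Q *\<^sub>t \<A>"
    using Q m carrier by (simp add: mat_mult_tensor_add_mat[of _ n] mat_mult_tensor_one)
  then have "tensor_form m n ((1\<^sub>m n + Q) *\<^sub>t \<A>) x i
      = tensor_form m n \<A> x i + tensor_form m n (Q *\<^sub>t \<A>) x i"
    by (simp add: tensor_form_def distrib_right sum.distrib)
  moreover have "0 \<le> tensor_form m n (Q *\<^sub>t \<A>) x i"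
    using assms Q by (auto simp: tensor_form_mat_mult dominated_def intro!: sum_nonneg mult_nonneg_nonneg
        intro: less_imp_le)
  ultimately show ?thesis using x(2)[OF \<open>i < n\<close>] by simp
qed

section \<open>Convergence of the splittings in (a)\<close>

text \<open>The inverse of 1 + Q need not be nonnegative, but it cancels against both tensors: the
  iteration tensor is \<open>off\<close>, and positivity is needed for \<A> itself. Invertibility
  comes from dominance with weights given by the power \<open>m - 1\<close> of
  \<open>x\<close>.\<close>

lemma convergent_preconditioned:
  assumes Q: "dominated Q"
  shows "convergent_splitting m n ((1\<^sub>m n + Q) *\<^sub>t \<A>) ((1\<^sub>m n + Q) *\<^sub>t id_tensor m n)
    ((1\<^sub>m n + Q) *\<^sub>t off)"
proof -
  have Qc: "Q \<in> carrier_mat n n" using Q by (rule dominated_carrier)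
  obtain x where x: "\<And>i. i < n \<Longrightarrow> 0 < x i" "\<And>i. i < n \<Longrightarrow> 0 < tensor_form m n \<A> x i"
    using positive_vector by blast
  have "(\<Sum>j<n. \<bar>Q $$ (i, j)\<bar> * x j ^ (m - 1)) < x i ^ (m - 1)" if i: "i < n" for i
  proof -
    have "(\<Sum>j<n. \<bar>Q $$ (i, j)\<bar> * x j ^ (m - 1)) \<le>
        (\<Sum>j<n. off (i # replicate (m - 1) j) * x j ^ (m - 1))"
      using x(1) Q i by (intro sum_mono mult_right_mono) (auto simp: dominated_def intro: less_imp_le)
    also have "\<dots> \<le> tensor_form m n off x i"
      using x(1) i by (rule off_majorization_le)
    also have "\<dots> < x i ^ (m - 1)"
      using x(2)[OF i] i m by (simp add: off_def tensor_form_diff tensor_form_id)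
    finally show ?thesis .
  qed
  then obtain N where N: "N \<in> carrier_mat n n" "(1\<^sub>m n + Q) * N = 1\<^sub>m n" "N * (1\<^sub>m n + Q) = 1\<^sub>m n"
    using invertible_one_plus[OF Qc, of "\<lambda>i. x i ^ (m - 1)"] x(1) by (auto simp del: One_nat_def)
  have cancel: "N *\<^sub>t ((1\<^sub>m n + Q) *\<^sub>t \<T>) = \<T>" if "\<T> \<in> carrier_tensor m n" for \<T>
    using N Qc m that by (simp add: mat_mult_tensor_assoc[symmetric, of _ n] mat_mult_tensor_one)
  have off: "off \<in> carrier_tensor m n"
    unfolding off_def using carrier id_tensor_carrier by (rule diff_carrier_tensor[rotated])
  show ?thesis
  proof (rule convergent_splittingI[OF m _ _ N(1) N(2,3) refl])
    show "(1\<^sub>m n + Q) *\<^sub>t off = (1\<^sub>m n + Q) *\<^sub>t id_tensor m n - (1\<^sub>m n + Q) *\<^sub>t \<A>"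
      unfolding off_def using Qc by (simp add: mat_mult_tensor_diff[of _ n])
    show "0 < x i" if "i < n" for i using x that by blast
    show "0 < tensor_form m n (N *\<^sub>t ((1\<^sub>m n + Q) *\<^sub>t \<A>)) x i" if "i < n" for i
      using x(2)[OF that] by (simp add: cancel carrier)
  qed (use n Qc Q preconditioned_carrier nonneg_off in \<open>auto simp: cancel off\<close>)
qed

text \<open>Serves the second, third and fourth splittings. Here \<open>M\<close> and
  \<open>N\<close> are the identity matrix, so the iteration tensor is the nonnegative sum in
  \<open>preconditioned_eq\<close>.\<close>

lemma convergent_jacobi:
  assumes Q: "dominated Q"
  shows "convergent_splitting m n ((1\<^sub>m n + Q) *\<^sub>t \<A>) (id_tensor m n)
    ((1\<^sub>m n + Q) *\<^sub>t off - Q *\<^sub>t id_tensor m n)"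
proof -
  have Qc: "Q \<in> carrier_mat n n" using Q by (rule dominated_carrier)
  obtain x where x: "\<And>i. i < n \<Longrightarrow> 0 < x i" "\<And>i. i < n \<Longrightarrow> 0 < tensor_form m n \<A> x i"
    using positive_vector by blast
  have eq: "(1\<^sub>m n + Q) *\<^sub>t off - Q *\<^sub>t id_tensor m n = off - Q *\<^sub>t id_tensor m n + Q *\<^sub>t off"
    by (simp add: preconditioned_eq[OF Q])
  have nonneg: "nonneg_tensor (off - Q *\<^sub>t id_tensor m n + Q *\<^sub>t off)"
    using Q Qc by (intro nonneg_tensor_add nonneg_off_minus nonneg_mat_mult_tensor[of _ n] nonneg_off)
      (auto simp: dominated_def)
  have \<C>: "(1\<^sub>m n + Q) *\<^sub>t \<A> \<in> carrier_tensor m n"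
    using Q by (rule preconditioned_carrier)
  have \<G>: "off - Q *\<^sub>t id_tensor m n + Q *\<^sub>t off = id_tensor m n - (1\<^sub>m n + Q) *\<^sub>t \<A>"
    by (simp add: preconditioned_eq(1)[OF Q])
  have "off - Q *\<^sub>t id_tensor m n + Q *\<^sub>t off \<in> carrier_tensor m n"
    unfolding \<G> using id_tensor_carrier \<C> by (rule diff_carrier_tensor)
  then have one: "1\<^sub>m n *\<^sub>t (off - Q *\<^sub>t id_tensor m n + Q *\<^sub>t off) = off - Q *\<^sub>t id_tensor m n + Q *\<^sub>t off"
    using m by (simp add: mat_mult_tensor_one)
  show ?thesis unfolding eq
  proof (rule convergent_splittingI[OF m _ one_carrier_mat one_carrier_mat])
    show "id_tensor m n = 1\<^sub>m n *\<^sub>t id_tensor m n"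
      using m by (simp add: mat_mult_tensor_one[OF id_tensor_carrier])
    show "0 < x i" if "i < n" for i using x that by blast
    show "0 < tensor_form m n (1\<^sub>m n *\<^sub>t ((1\<^sub>m n + Q) *\<^sub>t \<A>)) x i" if "i < n" for i
      using preconditioned_positive[OF Q x that] \<C> m by (simp add: mat_mult_tensor_one)
  qed (use n \<C> \<G> nonneg one in auto)
qed

lemma entry_bounds:
  assumes "i < n" "j < n" "i \<noteq> j" "0 \<le> c" "c \<le> 1"
  shows "0 \<le> - c * \<A> (i # replicate (m - 1) j)"
    and "- c * \<A> (i # replicate (m - 1) j) \<le> off (i # replicate (m - 1) j)"
proof -
  have eq: "off (i # replicate (m - 1) j) = - \<A> (i # replicate (m - 1) j)"
    using assms m by (auto simp: off_def id_tensor_Cons replicate_eq_replicate_iff_pos simp del: One_nat_def)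
  moreover have "0 \<le> off (i # replicate (m - 1) j)"
    by (rule off_entry_nonneg)
  ultimately show "0 \<le> - c * \<A> (i # replicate (m - 1) j)"
    "- c * \<A> (i # replicate (m - 1) j) \<le> off (i # replicate (m - 1) j)"
    using assms mult_right_mono[of c 1 "- \<A> (i # replicate (m - 1) j)"]
    by (auto simp: mult_nonneg_nonpos)
qed

lemma dominated_S:
  assumes "1 \<le> s" "\<forall>i<n - s. \<alpha> i \<in> {0..1}"
  shows "dominated (S_mat m n \<A> s \<alpha>)"
proof -
  have "\<alpha> i \<in> {0..1}" if "i + s < n" for i using that assms by auto
  then show ?thesis
    using assms(1) entry_bounds off_entry_nonneg by (auto simp: dominated_def S_mat_def)
qed

lemma dominated_K:
  assumes "1 \<le> k" "\<forall>j\<in>{k..<n}. \<beta> j \<in> {0..1}"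
  shows "dominated (K_mat m n \<A> k \<beta>)"
proof -
  \<comment> \<open>\<open>K_mat\<close> takes its parameter from the row, and its nonzero rows are
    \<open>k\<close> to \<open>n - 1\<close>.\<close>
  have "\<beta> (j + k) \<in> {0..1}" if "j + k < n" for j using that assms by auto
  then show ?thesis
    using assms(1) entry_bounds off_entry_nonneg by (auto simp: dominated_def K_mat_def)
qed

text \<open>One matrix lives strictly above the diagonal and the other strictly below, so each entry
  of the sum comes from at most one of them.\<close>

lemma dominated_S_plus_K:
  assumes "1 \<le> s" "1 \<le> k" "\<forall>i<n - s. \<alpha> i \<in> {0..1}" "\<forall>j\<in>{k..<n}. \<beta> j \<in> {0..1}"
  shows "dominated (S_mat m n \<A> s \<alpha> + K_mat m n \<A> k \<beta>)"
proof -
  let ?S = "S_mat m n \<A> s \<alpha>" and ?K = "K_mat m n \<A> k \<beta>"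
  have S: "dominated ?S" and K: "dominated ?K"
    using assms dominated_S dominated_K by auto
  have "0 \<le> (?S + ?K) $$ (i, j) \<and> (?S + ?K) $$ (i, j) \<le> off (i # replicate (m - 1) j)"
    if "i < n" "j < n" for i j
  proof -
    have "?S $$ (i, j) = 0 \<or> ?K $$ (i, j) = 0"
      using that assms by (auto simp: S_mat_def K_mat_def)
    moreover have "(?S + ?K) $$ (i, j) = ?S $$ (i, j) + ?K $$ (i, j)"
      using that K[THEN dominated_carrier] by auto
    ultimately show ?thesis
      using that S K unfolding dominated_def by auto
  qed
  then show ?thesis
    using K[THEN dominated_carrier] by (simp add: dominated_def)
qed

text \<open>The step-1 factors make \<open>S\<^sub>\<alpha> K\<close> and \<open>K\<^sub>\<beta> S\<close> diagonal, so that \<open>M(\<E>\<^sub>5)\<close> is diagonal with these entries.\<close>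

definition diag_entry :: "(nat \<Rightarrow> real) \<Rightarrow> (nat \<Rightarrow> real) \<Rightarrow> nat \<Rightarrow> real" where
  "diag_entry \<alpha> \<beta> i = 1
     - (if i + 1 < n then \<alpha> i * \<A> (i # replicate (m - 1) (i + 1)) * \<A> ((i + 1) # replicate (m - 1) i) else 0)
     - (if 1 \<le> i then \<beta> i * \<A> (i # replicate (m - 1) (i - 1)) * \<A> ((i - 1) # replicate (m - 1) i) else 0)"

lemma diag_mat_eq:
  "1\<^sub>m n - S_mat m n \<A> 1 \<alpha> * K_mat m n \<A> 1 (\<lambda>_. 1) - K_mat m n \<A> 1 \<beta> * S_mat m n \<A> 1 (\<lambda>_. 1)
     = mat n n (\<lambda>(i, j). if i = j then diag_entry \<alpha> \<beta> i else 0)"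
  (is "1\<^sub>m n - ?SK - ?KS = ?D")
proof (rule eq_matI)
  fix i j assume "i < dim_row ?D" "j < dim_col ?D"
  then have ij: "i < n" "j < n" by auto
  define a where "a = (\<lambda>i j. \<A> (i # replicate (m - 1) j))"
  have "?SK $$ (i, j) = (\<Sum>l<n. (if l = i + 1 then - \<alpha> i * a i l else 0) * (if l = j + 1 then - a l j else 0))"
    using ij by (auto simp: S_mat_def K_mat_def scalar_prod_def lessThan_atLeast0 a_def intro!: sum.cong)
  \<comment> \<open>Both conditions on \<open>l\<close> hold together only if i = j; the two minus
    signs cancel.\<close>
  also have "\<dots> = (\<Sum>l<n. if l = i + 1 then (if i = j then \<alpha> i * a i (i + 1) * a (i + 1) i else 0) else 0)"
    by (intro sum.cong) auto
  finally have SK: "?SK $$ (i, j) = (if i = j \<and> i + 1 < n then \<alpha> i * a i (i + 1) * a (i + 1) i else 0)"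
    by simp
  have "?KS $$ (i, j) = (\<Sum>l<n. (if i = l + 1 then - \<beta> i * a i l else 0) * (if j = l + 1 then - a l j else 0))"
    using ij by (auto simp: S_mat_def K_mat_def scalar_prod_def lessThan_atLeast0 a_def intro!: sum.cong)
  \<comment> \<open>Subtraction is truncated, so for i = 0 the condition picks l = 0; the guard
    \<open>1 \<le> i\<close> removes that term.\<close>
  also have "\<dots> = (\<Sum>l<n. if l = i - 1 then (if i = j \<and> 1 \<le> i then \<beta> i * a i (i - 1) * a (i - 1) i else 0) else 0)"
    by (intro sum.cong) auto
  also have "\<dots> = (if i = j \<and> 1 \<le> i then \<beta> i * a i (i - 1) * a (i - 1) i else 0)"
    using ij by auto
  finally show "(1\<^sub>m n - ?SK - ?KS) $$ (i, j) = ?D $$ (i, j)"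
    using ij SK by (simp add: diag_entry_def a_def S_mat_def K_mat_def)
qed (simp_all add: S_mat_def K_mat_def)

text \<open>The matrix \<open>M\<close> is diagonal with positive entries, so its inverse is
  nonnegative and only rescales rows. This preserves nonnegativity of the three summands of the
  remainder and positivity of the preconditioned form. \<open>S1\<close> and \<open>K1\<close> stand
  for the matrices with all parameters 1.\<close>

lemma convergent_diagonal:
  assumes S: "dominated S" "dominated S1" and K: "dominated K" "dominated K1" and SK: "dominated (S + K)"
    and D: "1\<^sub>m n - S * K1 - K * S1 = mat n n (\<lambda>(i, j). if i = j then d i else 0)"
    and d: "\<And>i. i < n \<Longrightarrow> 0 < d i"
  shows "convergent_splitting m n ((1\<^sub>m n + (S + K)) *\<^sub>t \<A>)
    ((1\<^sub>m n - S * K1 - K * S1) *\<^sub>t id_tensor m n)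
    (off - (S + K) *\<^sub>t id_tensor m n + S *\<^sub>t (off - K1 *\<^sub>t id_tensor m n)
      + K *\<^sub>t (off - S1 *\<^sub>t id_tensor m n))"
    (is "convergent_splitting m n ?C ?E ?G")
proof -
  note c = S[THEN dominated_carrier] K[THEN dominated_carrier]
  define M where "M = 1\<^sub>m n - S * K1 - K * S1"
  define N where "N = mat n n (\<lambda>(i, j). if i = j then 1 / d i else 0)"
  have Mc: "M \<in> carrier_mat n n" and Nc: "N \<in> carrier_mat n n"
    by (simp_all add: M_def N_def D)
  have prod: "mat n n (\<lambda>(i, j). if i = j then f i else 0) * mat n n (\<lambda>(i, j). if i = j then g i else 0) = 1\<^sub>m n"
    if fg: "\<And>i. i < n \<Longrightarrow> f i * g i = 1" for f g :: "nat \<Rightarrow> real"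
  proof (rule eq_matI)
    fix i j assume "i < dim_row (1\<^sub>m n :: real mat)" "j < dim_col (1\<^sub>m n :: real mat)"
    then have ij: "i < n" "j < n" by auto
    have "(\<Sum>l<n. (if i = l then f i else 0) * (if l = j then g l else 0))
        = (\<Sum>l<n. if l = i then (if i = j then f i * g i else 0) else 0)"
      by (intro sum.cong) auto
    then show "(mat n n (\<lambda>(i, j). if i = j then f i else 0) * mat n n (\<lambda>(i, j). if i = j then g i else 0)) $$ (i, j)
        = 1\<^sub>m n $$ (i, j)"
      using ij fg by (simp add: scalar_prod_def lessThan_atLeast0)
  qed simp_all
  have MN: "M * N = 1\<^sub>m n" and NM: "N * M = 1\<^sub>m n"
    unfolding M_def N_def D using d by (auto intro!: prod simp: less_imp_neq[symmetric])
  obtain x where x: "\<And>i. i < n \<Longrightarrow> 0 < x i" "\<And>i. i < n \<Longrightarrow> 0 < tensor_form m n \<A> x i"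
    using positive_vector by blast
  have E: "M *\<^sub>t id_tensor m n = id_tensor m n - S *\<^sub>t (K1 *\<^sub>t id_tensor m n) - K *\<^sub>t (S1 *\<^sub>t id_tensor m n)"
    unfolding M_def using c m
    by (simp add: mat_mult_tensor_diff_mat[of _ n] mat_mult_tensor_assoc[of _ n] minus_carrier_mat
        mat_mult_tensor_one[OF id_tensor_carrier])
  have "(S + K) *\<^sub>t off = S *\<^sub>t off + K *\<^sub>t off"
    using c by (simp add: mat_mult_tensor_add_mat[of _ n])
  \<comment> \<open>The products \<open>S * K1\<close> and \<open>K * S1\<close> subtracted in
    \<open>M\<close> are exactly the corrections inside the last two summands.\<close>
  then have G: "?G = M *\<^sub>t id_tensor m n - ?C"
    using c by (simp add: preconditioned_eq(1)[OF SK] E mat_mult_tensor_diff[of _ n])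
  have "nonneg_tensor ?G"
    using S K SK c
    by (intro nonneg_tensor_add nonneg_off_minus nonneg_mat_mult_tensor[of _ n]) (auto simp: dominated_def)
  then have nonneg: "nonneg_tensor (N *\<^sub>t ?G)"
    using Nc d by (intro nonneg_mat_mult_tensor[of _ n]) (auto simp: N_def less_imp_le)
  have "0 < tensor_form m n (N *\<^sub>t ?C) x i" if i: "i < n" for i
  proof -
    have "tensor_form m n (N *\<^sub>t ?C) x i = (\<Sum>l<n. if l = i then 1 / d i * tensor_form m n ?C x i else 0)"
      unfolding tensor_form_mat_mult[OF Nc i] using i by (intro sum.cong) (auto simp: N_def)
    then show ?thesis
      using i d[OF i] preconditioned_positive[OF SK x i] by simp
  qed
  with x(1) show ?thesis
    using convergent_splittingI[OF m _ Mc Nc MN NM refl preconditioned_carrier[OF SK] G nonneg, of x] n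
    by (simp add: M_def)
qed

end

theorem proposition3:
  fixes m n :: nat and \<A> :: tensor
  assumes "m \<ge> 2" and "n \<ge> 2"
    and "\<A> \<in> carrier_tensor m n"
    and "strong_M_tensor m n \<A>"
    and "\<And>i. i < n \<Longrightarrow> \<A> (replicate m i) = 1"
  shows
    "(\<forall>s k (\<alpha> :: nat \<Rightarrow> real) (\<beta> :: nat \<Rightarrow> real).
        1 \<le> s \<and> s \<le> n - 1 \<and> 1 \<le> k \<and> k \<le> n - 1 \<and>
        (\<forall>i<n - s. \<alpha> i \<in> {0..1}) \<and> (\<forall>j\<in>{k..<n}. \<beta> j \<in> {0..1}) \<longrightarrow>
        (let \<I> = id_tensor m n; \<L> = lower_tensor m n \<A>; \<F> = rest_tensor m n \<A>;
             S = S_mat m n \<A> s \<alpha>; K = K_mat m n \<A> k \<beta>;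
             P\<^sub>\<alpha>\<^sub>\<beta> = 1\<^sub>m n + S + K; P\<^sub>\<alpha> = 1\<^sub>m n + S; P\<^sub>\<beta> = 1\<^sub>m n + K
         in convergent_splitting m n (P\<^sub>\<alpha>\<^sub>\<beta> *\<^sub>t \<A>) (P\<^sub>\<alpha>\<^sub>\<beta> *\<^sub>t \<I>) (P\<^sub>\<alpha>\<^sub>\<beta> *\<^sub>t (\<L> + \<F>)) \<and>
            convergent_splitting m n (P\<^sub>\<alpha>\<^sub>\<beta> *\<^sub>t \<A>) \<I> (P\<^sub>\<alpha>\<^sub>\<beta> *\<^sub>t (\<L> + \<F>) - (S + K) *\<^sub>t \<I>) \<and>
            convergent_splitting m n (P\<^sub>\<alpha> *\<^sub>t \<A>) \<I> (P\<^sub>\<alpha> *\<^sub>t (\<L> + \<F>) - S *\<^sub>t \<I>) \<and>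
            convergent_splitting m n (P\<^sub>\<beta> *\<^sub>t \<A>) \<I> (P\<^sub>\<beta> *\<^sub>t (\<L> + \<F>) - K *\<^sub>t \<I>))) \<and>
     (\<forall>(\<alpha> :: nat \<Rightarrow> real) (\<beta> :: nat \<Rightarrow> real).
        (let \<I> = id_tensor m n; \<L> = lower_tensor m n \<A>; \<F> = rest_tensor m n \<A>;
             \<L>' = lower_tensor' m n \<A>; \<F>' = rest_tensor' m n \<A>;
             S\<^sub>\<alpha> = S_mat m n \<A> 1 \<alpha>; K\<^sub>\<beta> = K_mat m n \<A> 1 \<beta>;
             S = S_mat m n \<A> 1 (\<lambda>_. 1); K = K_mat m n \<A> 1 (\<lambda>_. 1);
             a = (\<lambda>i j. \<A> (i # replicate (m - 1) j))
         in (\<forall>i<n - 1. \<alpha> i \<in> {0..1}) \<and> (\<forall>j\<in>{1..<n}. \<beta> j \<in> {0..1}) \<and>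
            0 < \<alpha> 0 * a 0 1 * a 1 0 \<and> \<alpha> 0 * a 0 1 * a 1 0 < 1 \<and>
            (\<forall>i\<in>{1..<n - 1}.
               0 < \<alpha> i * a i (i + 1) * a (i + 1) i + \<beta> i * a i (i - 1) * a (i - 1) i \<and>
               \<alpha> i * a i (i + 1) * a (i + 1) i + \<beta> i * a i (i - 1) * a (i - 1) i < 1) \<and>
            0 < \<beta> (n - 1) * a (n - 1) (n - 2) * a (n - 2) (n - 1) \<and>
            \<beta> (n - 1) * a (n - 1) (n - 2) * a (n - 2) (n - 1) < 1 \<longrightarrow>
            convergent_splitting m n
              ((1\<^sub>m n + S\<^sub>\<alpha> + K\<^sub>\<beta>) *\<^sub>t \<A>)
              ((1\<^sub>m n - S\<^sub>\<alpha> * K - K\<^sub>\<beta> * S) *\<^sub>t \<I>)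
              (\<L> + \<F> - (S\<^sub>\<alpha> + K\<^sub>\<beta>) *\<^sub>t \<I> + S\<^sub>\<alpha> *\<^sub>t (\<L>' + \<F>) + K\<^sub>\<beta> *\<^sub>t (\<L> + \<F>'))))"
proof -
  interpret unit_strong_M_tensor m n \<A>
    using assms by unfold_locales
  have assoc: "1\<^sub>m n + S_mat m n \<A> s \<alpha> + K_mat m n \<A> k \<beta>
      = 1\<^sub>m n + (S_mat m n \<A> s \<alpha> + K_mat m n \<A> k \<beta>)" for s k \<alpha> \<beta>
    by (intro assoc_add_mat[of _ n n]) (simp_all add: S_mat_def K_mat_def)
  have lower': "lower_tensor' m n \<A> + rest_tensor m n \<A> = off - K_mat m n \<A> 1 (\<lambda>_. 1) *\<^sub>t id_tensor m n"
    by (simp add: lower_tensor'_def lower_plus_rest[symmetric])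
  have rest': "lower_tensor m n \<A> + rest_tensor' m n \<A> = off - S_mat m n \<A> 1 (\<lambda>_. 1) *\<^sub>t id_tensor m n"
    by (simp add: rest_tensor'_def lower_plus_rest[symmetric])
  have diag_entry_pos: "0 < diag_entry \<alpha> \<beta> i"
    if asm: "i < n"
      "\<alpha> 0 * \<A> (0 # replicate (m - 1) 1) * \<A> (1 # replicate (m - 1) 0) < 1"
      "\<forall>i\<in>{1..<n - 1}.
        \<alpha> i * \<A> (i # replicate (m - 1) (i + 1)) * \<A> ((i + 1) # replicate (m - 1) i) +
        \<beta> i * \<A> (i # replicate (m - 1) (i - 1)) * \<A> ((i - 1) # replicate (m - 1) i) < 1"
      "\<beta> (n - 1) * \<A> ((n - 1) # replicate (m - 1) (n - 2)) *
        \<A> ((n - 2) # replicate (m - 1) (n - 1)) < 1"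
    for \<alpha> \<beta> i
  proof -
    \<comment> \<open>The first, inner and last rows correspond to the three bounds; in the end rows
      only one neighbour contributes.\<close>
    consider "i = 0" | "1 \<le> i" "i < n - 1" | "i = n - 1" "i \<noteq> 0"
      using asm(1) by linarith
    then show ?thesis
    proof cases
      case 1
      then show ?thesis using asm(2) \<open>n \<ge> 2\<close> by (simp add: diag_entry_def)
    next
      case 2
      then have "i + 1 < n" by linarith
      with 2 show ?thesis using bspec[OF asm(3), of i] by (simp add: diag_entry_def)
    next
      case 3
      have "n - 1 - 1 = n - 2" by simp
      with 3 show ?thesis using asm(4) \<open>n \<ge> 2\<close> by (simp add: diag_entry_def)
    qed
  qed
  \<comment> \<open>Everything is expressed through \<open>off\<close>, and the preconditioner is
    reassociated to the form 1 + Q of the general lemmas.\<close>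
  show ?thesis
    unfolding Let_def lower_plus_rest lower' rest' assoc
  proof (intro conjI allI impI; elim conjE)
    fix s k and \<alpha> \<beta> :: "nat \<Rightarrow> real"
    assume "1 \<le> s" "1 \<le> k" "\<forall>i<n - s. \<alpha> i \<in> {0..1}" "\<forall>j\<in>{k..<n}. \<beta> j \<in> {0..1}"
    then have S: "dominated (S_mat m n \<A> s \<alpha>)" and K: "dominated (K_mat m n \<A> k \<beta>)"
      and SK: "dominated (S_mat m n \<A> s \<alpha> + K_mat m n \<A> k \<beta>)"
      by (auto intro!: dominated_S dominated_K dominated_S_plus_K)
    let ?S = "S_mat m n \<A> s \<alpha>" and ?K = "K_mat m n \<A> k \<beta>"
    show "convergent_splitting m n ((1\<^sub>m n + (?S + ?K)) *\<^sub>t \<A>)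
        ((1\<^sub>m n + (?S + ?K)) *\<^sub>t id_tensor m n) ((1\<^sub>m n + (?S + ?K)) *\<^sub>t off)"
      using SK by (rule convergent_preconditioned)
    show "convergent_splitting m n ((1\<^sub>m n + (?S + ?K)) *\<^sub>t \<A>) (id_tensor m n)
        ((1\<^sub>m n + (?S + ?K)) *\<^sub>t off - (?S + ?K) *\<^sub>t id_tensor m n)"
      using SK by (rule convergent_jacobi)
    show "convergent_splitting m n ((1\<^sub>m n + ?S) *\<^sub>t \<A>) (id_tensor m n)
        ((1\<^sub>m n + ?S) *\<^sub>t off - ?S *\<^sub>t id_tensor m n)"
      using S by (rule convergent_jacobi)
    show "convergent_splitting m n ((1\<^sub>m n + ?K) *\<^sub>t \<A>) (id_tensor m n)
        ((1\<^sub>m n + ?K) *\<^sub>t off - ?K *\<^sub>t id_tensor m n)"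
      using K by (rule convergent_jacobi)
  next
    fix \<alpha> \<beta> :: "nat \<Rightarrow> real"
    assume ab: "\<forall>i<n - 1. \<alpha> i \<in> {0..1}" "\<forall>j\<in>{1..<n}. \<beta> j \<in> {0..1}"
      and d: "\<alpha> 0 * \<A> (0 # replicate (m - 1) 1) * \<A> (1 # replicate (m - 1) 0) < 1"
      "\<forall>i\<in>{1..<n - 1}.
        0 < \<alpha> i * \<A> (i # replicate (m - 1) (i + 1)) * \<A> ((i + 1) # replicate (m - 1) i) +
          \<beta> i * \<A> (i # replicate (m - 1) (i - 1)) * \<A> ((i - 1) # replicate (m - 1) i) \<and>
        \<alpha> i * \<A> (i # replicate (m - 1) (i + 1)) * \<A> ((i + 1) # replicate (m - 1) i) +
          \<beta> i * \<A> (i # replicate (m - 1) (i - 1)) * \<A> ((i - 1) # replicate (m - 1) i) < 1"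
      "\<beta> (n - 1) * \<A> ((n - 1) # replicate (m - 1) (n - 2)) *
        \<A> ((n - 2) # replicate (m - 1) (n - 1)) < 1"
    show "convergent_splitting m n
        ((1\<^sub>m n + (S_mat m n \<A> 1 \<alpha> + K_mat m n \<A> 1 \<beta>)) *\<^sub>t \<A>)
        ((1\<^sub>m n - S_mat m n \<A> 1 \<alpha> * K_mat m n \<A> 1 (\<lambda>_. 1)
          - K_mat m n \<A> 1 \<beta> * S_mat m n \<A> 1 (\<lambda>_. 1)) *\<^sub>t id_tensor m n)
        (off - (S_mat m n \<A> 1 \<alpha> + K_mat m n \<A> 1 \<beta>) *\<^sub>t id_tensor m n
          + S_mat m n \<A> 1 \<alpha> *\<^sub>t (off - K_mat m n \<A> 1 (\<lambda>_. 1) *\<^sub>t id_tensor m n)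
          + K_mat m n \<A> 1 \<beta> *\<^sub>t (off - S_mat m n \<A> 1 (\<lambda>_. 1) *\<^sub>t id_tensor m n))"
    proof (rule convergent_diagonal[OF _ _ _ _ _ diag_mat_eq])
      show "0 < diag_entry \<alpha> \<beta> i" if "i < n" for i
        using d by (intro diag_entry_pos[OF that]) blast+
    qed (use ab in \<open>auto intro!: dominated_S dominated_K dominated_S_plus_K\<close>)
  qed
qed

end
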